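(* Let $\mathcal{F}$ be convex, lower semi-continuous and separably $*$-increasing, with some $\pi\in\Pi(\mathbb{P},\mathbb{Q})$ satisfying $\mathcal{F}(\pi)<\infty$. Let $v^*\in\mathcal{C}(\mathcal{Y})$ be an optimal potential, i.e. $v^*\in\arg\sup_{v\in\mathcal{C}(\mathcal{Y})}\inf_{\pi\in\Pi(\mathbb{P})}\mathcal{L}(v,\pi)$. Then for every OT plan $\pi^*\in\Pi(\mathbb{P},\mathbb{Q})$ (i.e. every minimizer of $\mathcal{F}$ over $\Pi(\mathbb{P},\mathbb{Q})$) it holds that $\pi^*\in\arg\inf_{\pi\in\Pi(\mathbb{P})}\mathcal{L}(v^*,\pi)$.
   Context: Let $D\ge 1$ and let $\mathcal{X}=\mathcal{Y}\subset\mathbb{R}^D$ be compact; $\mathbb{P}\in\mathcal{P}(\mathcal{X})$, $\mathbb{Q}\in\mathcal{P}(\mathcal{Y})$. $\mathcal{C}(\mathcal{S})$ denotes continuous real functions, $\mathcal{M}(\mathcal{S})$ finite signed Borel measures, $\mathcal{P}(\mathcal{S})$ Borel probability measures; lower semi-continuity is w.r.t. the weak-$*$ topology. $\Pi(\mathbb{P})$: probability measures on $\mathcal{X}\times\mathcal{Y}$ with first marginal $\mathbb{P}$; $\Pi(\mathbb{P},\mathbb{Q})$: those with marginals $\mathbb{P},\mathbb{Q}$. $\mathcal{F}^*(h)=\sup_{\pi\in\mathcal{M}(\mathcal{X}\times\mathcal{Y})}[\int h\,d\pi-\mathcal{F}(\pi)]$. $\mathcal{F}$ is separably $*$-increasing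 if $u(x)+v(y)\le c(x,y)$ pointwise ($u\in\mathcal{C}(\mathcal{X}),v\in\mathcal{C}(\mathcal{Y}),c\in\mathcal{C}(\mathcal{X}\times\mathcal{Y})$) implies $\mathcal{F}^*(u\oplus v)\le\mathcal{F}^*(c)$, where $(u\oplus v)(x,y)=u(x)+v(y)$. $\mathrm{Cost}(\mathbb{P},\mathbb{Q})=\inf_{\pi\in\Pi(\mathbb{P},\mathbb{Q})}\mathcal{F}(\pi)$. For $v\in\mathcal{C}(\mathcal{Y})$, $\pi\in\Pi(\mathbb{P})$: $\mathcal{L}(v,\pi)=\mathcal{F}(\pi)-\int_{\mathcal{Y}}v\,d\pi_{\mathcal{Y}}+\int_{\mathcal{Y}}v\,d\mathbb{Q}$, $\pi_{\mathcal{Y}}$ the second marginal of $\pi$. *)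

theory Defs
  imports "HOL-Analysis.Analysis" "HOL-Probability.Probability"
begin

definition sm_sets :: "'a::topological_space set \<Rightarrow> 'a set set" where
  "sm_sets S = sets (restrict_space borel S)"

text \<open>A finite signed Borel measure on S: a real-valued, countably additive function
  on the Borel subsets of S (set to 0 on non-Borel sets, to fix a canonical representative).\<close>
definition signed_measure_on :: "'a::topological_space set \<Rightarrow> ('a set \<Rightarrow> real) \<Rightarrow> bool" where
  "signed_measure_on S \<mu> \<longleftrightarrow>
     (\<forall>A. A \<notin> sm_sets S \<longrightarrow> \<mu> A = 0) \<and>
     (\<forall>F::nat \<Rightarrow> 'a set. range F \<subseteq> sm_sets S \<longrightarrow> disjoint_family F \<longrightarrow>
        (\<lambda>n. \<mu> (F n)) sums \<mu> (\<Union>n. F n))"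

definition prob_measure_on :: "'a::topological_space set \<Rightarrow> ('a set \<Rightarrow> real) \<Rightarrow> bool" where
  "prob_measure_on S \<mu> \<longleftrightarrow> signed_measure_on S \<mu> \<and> (\<forall>A. 0 \<le> \<mu> A) \<and> \<mu> S = 1"

definition pos_var :: "'a::topological_space set \<Rightarrow> ('a set \<Rightarrow> real) \<Rightarrow> 'a set \<Rightarrow> real" where
  "pos_var S \<mu> A = (SUP B \<in> {B \<in> sm_sets S. B \<subseteq> A}. \<mu> B)"

definition sm_pos :: "'a::topological_space set \<Rightarrow> ('a set \<Rightarrow> real) \<Rightarrow> 'a measure" where
  "sm_pos S \<mu> = measure_of S (sm_sets S) (\<lambda>A. ennreal (pos_var S \<mu> A))"

definition sm_neg :: "'a::topological_space set \<Rightarrow> ('a set \<Rightarrow> real) \<Rightarrow> 'a measure" where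
  "sm_neg S \<mu> = measure_of S (sm_sets S) (\<lambda>A. ennreal (pos_var S \<mu> A - \<mu> A))"

definition sm_integral :: "'a::topological_space set \<Rightarrow> ('a set \<Rightarrow> real) \<Rightarrow> ('a \<Rightarrow> real) \<Rightarrow> real" where
  "sm_integral S \<mu> h = integral\<^sup>L (sm_pos S \<mu>) h - integral\<^sup>L (sm_neg S \<mu>) h"

definition weak_star :: "'a::topological_space set \<Rightarrow> ('a set \<Rightarrow> real) topology" where
  "weak_star S = topology_generated_by
     {{\<mu>. signed_measure_on S \<mu> \<and> sm_integral S \<mu> h \<in> U} | h U. continuous_on S h \<and> open U}"

definition weak_star_lsc :: "'a::topological_space set \<Rightarrow> (('a set \<Rightarrow> real) \<Rightarrow> ereal) \<Rightarrow> bool" where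
  "weak_star_lsc S F \<longleftrightarrow>
     (\<forall>t::ereal. openin (weak_star S) {\<mu>. signed_measure_on S \<mu> \<and> t < F \<mu>})"

definition sm_convex :: "'a::topological_space set \<Rightarrow> (('a set \<Rightarrow> real) \<Rightarrow> ereal) \<Rightarrow> bool" where
  "sm_convex S F \<longleftrightarrow>
     (\<forall>\<mu> \<nu> t. signed_measure_on S \<mu> \<longrightarrow> signed_measure_on S \<nu> \<longrightarrow> 0 \<le> t \<longrightarrow> t \<le> 1 \<longrightarrow>
        F (\<lambda>A. t * \<mu> A + (1 - t) * \<nu> A) \<le> ereal t * F \<mu> + ereal (1 - t) * F \<nu>)"

definition Fstar :: "'a::topological_space set \<Rightarrow> ((('a \<times> 'a) set \<Rightarrow> real) \<Rightarrow> ereal)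
                     \<Rightarrow> ('a \<times> 'a \<Rightarrow> real) \<Rightarrow> ereal" where
  "Fstar K F h = (SUP \<pi> \<in> {\<pi>. signed_measure_on (K \<times> K) \<pi>}.
                    ereal (sm_integral (K \<times> K) \<pi> h) - F \<pi>)"

definition sep_star_increasing :: "'a::topological_space set \<Rightarrow> ((('a \<times> 'a) set \<Rightarrow> real) \<Rightarrow> ereal) \<Rightarrow> bool" where
  "sep_star_increasing K F \<longleftrightarrow>
     (\<forall>u v c. continuous_on K u \<longrightarrow> continuous_on K v \<longrightarrow> continuous_on (K \<times> K) c \<longrightarrow>
        (\<forall>x\<in>K. \<forall>y\<in>K. u x + v y \<le> c (x, y)) \<longrightarrow>
        Fstar K F (\<lambda>(x, y). u x + v y) \<le> Fstar K F c)"

definition fst_marg :: "'a::topological_space set \<Rightarrow> (('a \<times> 'a) set \<Rightarrow> real) \<Rightarrow> 'a set \<Rightarrow> real" where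
  "fst_marg K \<pi> A = (if A \<in> sm_sets K then \<pi> (A \<times> K) else 0)"

definition snd_marg :: "'a::topological_space set \<Rightarrow> (('a \<times> 'a) set \<Rightarrow> real) \<Rightarrow> 'a set \<Rightarrow> real" where
  "snd_marg K \<pi> B = (if B \<in> sm_sets K then \<pi> (K \<times> B) else 0)"

definition Pi1 :: "'a::topological_space set \<Rightarrow> ('a set \<Rightarrow> real) \<Rightarrow> (('a \<times> 'a) set \<Rightarrow> real) set" where
  "Pi1 K P = {\<pi>. prob_measure_on (K \<times> K) \<pi> \<and> fst_marg K \<pi> = P}"

definition Pi2 :: "'a::topological_space set \<Rightarrow> ('a set \<Rightarrow> real) \<Rightarrow> ('a set \<Rightarrow> real)
                   \<Rightarrow> (('a \<times> 'a) set \<Rightarrow> real) set" where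
  "Pi2 K P Q = {\<pi>. prob_measure_on (K \<times> K) \<pi> \<and> fst_marg K \<pi> = P \<and> snd_marg K \<pi> = Q}"

definition Lag :: "'a::topological_space set \<Rightarrow> ((('a \<times> 'a) set \<Rightarrow> real) \<Rightarrow> ereal)
                   \<Rightarrow> ('a set \<Rightarrow> real) \<Rightarrow> ('a \<Rightarrow> real) \<Rightarrow> (('a \<times> 'a) set \<Rightarrow> real) \<Rightarrow> ereal" where
  "Lag K F Q v \<pi> = F \<pi> - ereal (sm_integral K (snd_marg K \<pi>) v) + ereal (sm_integral K Q v)"

end

theory Submission
  imports Defs
begin

text \<open>
  Since \<open>\<L>(v, \<pi>\<^sup>*) = F(\<pi>\<^sup>*)\<close> for every plan \<open>\<pi>\<^sup>*\<close>, the claim is the strong duality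
  \<open>sup\<^sub>v inf\<^sub>\<pi> \<L>(v, \<pi>) \<ge> F(\<pi>\<^sup>*)\<close>, a minimax statement on the weak-* compact convex set \<open>\<Pi>(P)\<close>.
  Let \<open>t\<close> be below the optimal cost and let \<open>v\<^sub>i\<close> be a sequence of continuous functions that
  determines probability measures on \<open>K\<close>. If for no \<open>n\<close> the finite family
  \<open>{j v\<^sub>i | i \<le> n, \<bar>j\<bar> \<le> n}\<close> satisfies \<open>max \<L>(j v\<^sub>i, \<pi>) \<ge> t\<close> on all of \<open>\<Pi>(P)\<close>, then a limit point
  \<open>\<rho>\<close> of violating measures has \<open>\<L>(j v\<^sub>i, \<rho>) \<le> t\<close> for all integers \<open>j\<close>, so its second marginal
  is \<open>Q\<close> and \<open>F \<rho> \<le> t\<close>, a contradiction. For a family that does satisfy the bound, a separation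
  argument yields one convex combination \<open>v\<close> with \<open>\<L>(v, \<cdot>) \<ge> t\<close> on \<open>\<Pi>(P)\<close>.

  Sequential compactness of the probability measures on a compact metric space is reduced to
  Helly's theorem on the line: the space embeds into the Cantor set by a Borel map whose inverse
  is uniformly continuous.
\<close>

section \<open>Probability measures as set functions\<close>

lemma sm_sets_iff: "closed S \<Longrightarrow> A \<in> sm_sets S \<longleftrightarrow> A \<subseteq> S \<and> A \<in> sets borel"
  unfolding sm_sets_def by (subst sets_restrict_space_iff) auto

lemma sigma_algebra_sm_sets: "sigma_algebra S (sm_sets S)"
  using sets.sigma_algebra_axioms[of "restrict_space borel S"]
  by (simp add: sm_sets_def space_restrict_space)

lemma sets_sm_pos: "sets (sm_pos S \<mu>) = sets (restrict_space borel S)"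
proof -
  interpret sigma_algebra S "sm_sets S" by (rule sigma_algebra_sm_sets)
  have "sets (sm_pos S \<mu>) = sm_sets S" unfolding sm_pos_def by simp
  then show ?thesis by (simp only: sm_sets_def)
qed

lemma space_sm_pos: "space (sm_pos S \<mu>) = S"
  using sets_eq_imp_space_eq[OF sets_sm_pos[of S \<mu>]] by (simp add: space_restrict_space)

text \<open>\<open>measure N\<close> is 0 on non-measurable sets, which is exactly the normalisation
  required by \<open>signed_measure_on\<close>. This is the passage from measures to set functions;
  \<open>prob_measure_onE\<close> is the way back.\<close>

lemma prob_measure_on_measure:
  fixes N :: "'a::topological_space measure"
  assumes "prob_space N" and N: "sets N = sets (restrict_space borel S)"
  shows "prob_measure_on S (measure N)"
proof -
  interpret prob_space N by fact
  have sp: "space N = S" using sets_eq_imp_space_eq[OF N] by (simp add: space_restrict_space)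
  show ?thesis
    unfolding prob_measure_on_def signed_measure_on_def sm_sets_def N[symmetric]
    using prob_space sp by (auto simp: measure_notin_sets intro!: finite_measure_UNION)
qed

text \<open>The empty sets form a disjoint family, and a constant series converges only if its term
  is 0.\<close>

lemma signed_measure_on_empty: "signed_measure_on S \<mu> \<Longrightarrow> \<mu> {} = 0"
proof -
  assume s: "signed_measure_on S \<mu>"
  have "(\<lambda>n::nat. \<mu> {}) sums \<mu> (\<Union>n::nat. {})"
    using s[unfolded signed_measure_on_def] sigma_algebra_sm_sets[of S]
    by (auto simp: disjoint_family_on_def sm_sets_def)
  then show ?thesis
    using sums_unique summable_const_iff by (metis sums_summable)
qed

lemma signed_measure_on_Un:
  assumes s: "signed_measure_on S \<mu>" and "A \<in> sm_sets S" "B \<in> sm_sets S" "A \<inter> B = {}"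
  shows "\<mu> (A \<union> B) = \<mu> A + \<mu> B"
proof -
  have "range (binaryset A B) \<subseteq> sm_sets S"
    using assms by (auto simp: range_binaryset_eq sm_sets_def)
  moreover have "disjoint_family (binaryset A B)"
    using assms by (auto simp: disjoint_family_on_def binaryset_def)
  ultimately have "(\<lambda>n. \<mu> (binaryset A B n)) sums \<mu> (\<Union>n. binaryset A B n)"
    using s unfolding signed_measure_on_def by blast
  moreover have "(\<lambda>n. \<mu> (binaryset A B n)) sums (\<mu> A + \<mu> B)"
    by (rule binaryset_sums) (rule signed_measure_on_empty[OF s])
  ultimately show ?thesis
    using sums_unique2 UN_binaryset_eq by metis
qed

section \<open>Jordan parts of a probability measure\<close>

text \<open>A nonnegative additive set function is monotone, so the supremum over Borel subsets of
  \<open>A\<close> is attained at \<open>A\<close> itself.\<close>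

lemma pos_var_prob:
  assumes "prob_measure_on S \<mu>" and A: "A \<in> sm_sets S"
  shows "pos_var S \<mu> A = \<mu> A"
proof -
  have s: "signed_measure_on S \<mu>" and nn: "\<And>A. 0 \<le> \<mu> A" using assms by (auto simp: prob_measure_on_def)
  have mono: "\<mu> B \<le> \<mu> A" if "B \<in> sm_sets S" "B \<subseteq> A" for B
  proof -
    have "\<mu> (B \<union> (A - B)) = \<mu> B + \<mu> (A - B)"
      by (rule signed_measure_on_Un[OF s]) (use A that in \<open>auto simp: sm_sets_def\<close>)
    also have "B \<union> (A - B) = A" using that by auto
    finally show ?thesis using nn[of "A - B"] by linarith
  qed
  show ?thesis unfolding pos_var_def
    by (rule cSup_eq_maximum) (use A mono in auto)
qed

lemma emeasure_sm_pos:
  assumes p: "prob_measure_on S \<mu>" and A: "A \<in> sm_sets S"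
  shows "emeasure (sm_pos S \<mu>) A = ennreal (\<mu> A)"
proof -
  have s: "signed_measure_on S \<mu>" and nn: "\<And>A. 0 \<le> \<mu> A" using assms by (auto simp: prob_measure_on_def)
  have "emeasure (sm_pos S \<mu>) A = ennreal (pos_var S \<mu> A)"
    unfolding sm_pos_def
  proof (rule emeasure_measure_of_sigma[OF sigma_algebra_sm_sets _ _ A])
    show "positive (sm_sets S) (\<lambda>A. ennreal (pos_var S \<mu> A))"
      using pos_var_prob[OF p] signed_measure_on_empty[OF s] by (auto simp: positive_def sm_sets_def)
    show "countably_additive (sm_sets S) (\<lambda>A. ennreal (pos_var S \<mu> A))"
    proof (rule countably_additiveI)
      fix F :: "nat \<Rightarrow> _" assume F: "range F \<subseteq> sm_sets S" "disjoint_family F" "(\<Union>i. F i) \<in> sm_sets S"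
      have "(\<lambda>n. \<mu> (F n)) sums \<mu> (\<Union>n. F n)" using s F unfolding signed_measure_on_def by blast
      then have "(\<Sum>n. ennreal (\<mu> (F n))) = ennreal (\<mu> (\<Union>n. F n))"
        using nn by (simp add: suminf_ennreal2 sums_iff)
      moreover have "pos_var S \<mu> (F n) = \<mu> (F n)" for n
        using F by (intro pos_var_prob[OF p]) auto
      ultimately show "(\<Sum>i. ennreal (pos_var S \<mu> (F i))) = ennreal (pos_var S \<mu> (\<Union>i. F i))"
        using pos_var_prob[OF p F(3)] by simp
    qed
  qed
  then show ?thesis using pos_var_prob[OF p A] by simp
qed

lemma prob_space_sm_pos:
  assumes p: "prob_measure_on S \<mu>" shows "prob_space (sm_pos S \<mu>)"
proof
  have "S \<in> sm_sets S"
    using sets.top[of "restrict_space borel S"] by (simp add: sm_sets_def space_restrict_space)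
  then show "emeasure (sm_pos S \<mu>) (space (sm_pos S \<mu>)) = 1"
    using p by (simp add: space_sm_pos emeasure_sm_pos prob_measure_on_def)
qed

lemma measure_sm_pos:
  assumes p: "prob_measure_on S \<mu>" shows "measure (sm_pos S \<mu>) = \<mu>"
proof
  fix A
  show "measure (sm_pos S \<mu>) A = \<mu> A"
  proof (cases "A \<in> sm_sets S")
    case True
    then show ?thesis using p emeasure_sm_pos[OF p True] by (simp add: measure_def prob_measure_on_def)
  next
    case False
    then show ?thesis using p sets_sm_pos[of S \<mu>]
      by (simp add: measure_notin_sets sm_sets_def prob_measure_on_def signed_measure_on_def)
  qed
qed

text \<open>On Borel sets \<open>pos_var S \<mu>\<close> agrees with \<open>\<mu>\<close>, so
  \<open>sm_neg S \<mu>\<close> is the null measure and only the integral over the positive part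
  survives.\<close>

lemma sm_integral_prob:
  assumes p: "prob_measure_on S \<mu>"
  shows "sm_integral S \<mu> h = integral\<^sup>L (sm_pos S \<mu>) h"
proof -
  interpret sigma_algebra S "sm_sets S" by (rule sigma_algebra_sm_sets)
  have 0: "ennreal (pos_var S \<mu> A - \<mu> A) = 0" if "A \<in> sm_sets S" for A
    using pos_var_prob[OF p that] by simp
  have "sm_neg S \<mu> = null_measure (restrict_space borel S)"
  proof (rule measure_eqI)
    show sets_eq: "sets (sm_neg S \<mu>) = sets (null_measure (restrict_space borel S))"
      unfolding sm_neg_def sets_measure_of_eq by (simp add: sm_sets_def[symmetric])
    fix A assume "A \<in> sets (sm_neg S \<mu>)"
    then have A: "A \<in> sm_sets S" unfolding sets_eq by (simp add: sm_sets_def)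
    have "emeasure (sm_neg S \<mu>) A = ennreal (pos_var S \<mu> A - \<mu> A)"
      unfolding sm_neg_def
    proof (rule emeasure_measure_of_sigma[OF sigma_algebra_sm_sets _ _ A])
      show "positive (sm_sets S) (\<lambda>A. ennreal (pos_var S \<mu> A - \<mu> A))"
        unfolding positive_def by (rule 0) simp
      show "countably_additive (sm_sets S) (\<lambda>A. ennreal (pos_var S \<mu> A - \<mu> A))"
      proof (rule countably_additiveI)
        fix F :: "nat \<Rightarrow> _" assume "range F \<subseteq> sm_sets S" "(\<Union>i. F i) \<in> sm_sets S"
        then have "ennreal (pos_var S \<mu> (F i) - \<mu> (F i)) = 0"
           "ennreal (pos_var S \<mu> (\<Union>i. F i) - \<mu> (\<Union>i. F i)) = 0" for i
          by (intro 0; auto)+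
        then show "(\<Sum>i. ennreal (pos_var S \<mu> (F i) - \<mu> (F i))) = ennreal (pos_var S \<mu> (\<Union>i. F i) - \<mu> (\<Union>i. F i))"
          by (simp only: suminf_zero)
      qed
    qed
    then show "emeasure (sm_neg S \<mu>) A = emeasure (null_measure (restrict_space borel S)) A"
      using 0[OF A] by simp
  qed
  then show ?thesis unfolding sm_integral_def by simp
qed

lemma sm_pos_measure:
  assumes N: "prob_space N" "sets N = sets (restrict_space borel S)"
  shows "sm_pos S (measure N) = N"
proof (rule measure_eqI)
  interpret prob_space N by fact
  show "sets (sm_pos S (measure N)) = sets N" using N by (simp add: sets_sm_pos)
  fix A assume "A \<in> sets (sm_pos S (measure N))"
  then show "emeasure (sm_pos S (measure N)) A = emeasure N A"
    using emeasure_sm_pos[OF prob_measure_on_measure[OF N], of A]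
    by (simp add: sets_sm_pos sm_sets_def emeasure_eq_measure)
qed

text \<open>The witness is \<open>sm_pos S \<mu>\<close>. It replaces the Jordan decomposition by a
  single measure to which ordinary integration theory applies.\<close>

lemma prob_measure_onE:
  assumes "prob_measure_on S \<mu>"
  obtains N where "prob_space N" "sets N = sets (restrict_space borel S)" "space N = S" "\<mu> = measure N"
    "\<And>h. sm_integral S \<mu> h = integral\<^sup>L N h"
  using prob_space_sm_pos[OF assms] sets_sm_pos space_sm_pos measure_sm_pos[OF assms] sm_integral_prob[OF assms]
  by (metis that)

lemma sm_integral_measure:
  assumes "prob_space N" "sets N = sets (restrict_space borel S)"
  shows "sm_integral S (measure N) h = integral\<^sup>L N h"
  using sm_integral_prob[OF prob_measure_on_measure[OF assms]] sm_pos_measure[OF assms] by simp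

section \<open>Sequential compactness of probability measures\<close>

text \<open>The base 3 expansion whose digits are 2 or 0 according to membership in
  \<open>B 0, B 1, ...\<close>. Avoiding the digit 1 leaves gaps between codes, so that digits can
  be recovered from approximate values.\<close>

definition ternary_code :: "(nat \<Rightarrow> 'a set) \<Rightarrow> 'a \<Rightarrow> real" where
  "ternary_code B x = (\<Sum>k. indicator (B k) x * (2 / 3 ^ Suc k))"

lemma summable_ternary: "summable (\<lambda>k. indicator (B k) x * (2 / 3 ^ Suc k :: real))"
proof (rule summable_comparison_test'[of "\<lambda>k. 2/3 * (1/3)^k" 0])
  show "summable (\<lambda>k. 2 / 3 * (1 / 3) ^ k :: real)" by (intro summable_mult summable_geometric) auto
qed (auto simp: indicator_def power_one_over field_simps)

lemma ternary_code_measurable: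
  assumes "\<And>k. B k \<in> sets M" shows "ternary_code B \<in> borel_measurable M"
  using assms unfolding ternary_code_def by measurable

lemma sums_ternary_tail: "(\<lambda>k. 2 / 3 ^ Suc (k + m) :: real) sums (1 / 3 ^ m)"
proof -
  have "(\<lambda>k. 2 / 3 ^ Suc m * (1 / 3) ^ k :: real) sums (2 / 3 ^ Suc m * (1 / (1 - 1/3)))"
    by (intro sums_mult geometric_sums) auto
  then show ?thesis by (simp add: power_one_over power_add field_simps)
qed

lemma ternary_code_bounds: "0 \<le> ternary_code B x \<and> ternary_code B x \<le> 1"
proof
  show "0 \<le> ternary_code B x" unfolding ternary_code_def
    by (intro suminf_nonneg summable_ternary) auto
  have "ternary_code B x \<le> (\<Sum>k. 2 / 3 ^ Suc k)" unfolding ternary_code_def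
    using sums_summable[OF sums_ternary_tail[of 0]]
    by (intro suminf_le summable_ternary) (auto simp: indicator_def)
  then show "ternary_code B x \<le> 1" using sums_ternary_tail[of 0] by (simp add: sums_iff)
qed

text \<open>Self-similarity: after \<open>m\<close> digits the remainder is again a ternary code,
  scaled by \<open>1 / 3 ^ m\<close>, so \<open>ternary_code_bounds\<close> applies to it.\<close>

lemma ternary_code_split:
  "ternary_code B x = (\<Sum>k<m. indicator (B k) x * (2 / 3 ^ Suc k)) +
     ternary_code (\<lambda>k. B (k + m)) x / 3 ^ m"
proof -
  have "ternary_code (\<lambda>k. B (k + m)) x / 3 ^ m =
      (\<Sum>k. indicator (B (k + m)) x * (2 / 3 ^ Suc k) / 3 ^ m)"
    unfolding ternary_code_def by (rule suminf_divide[OF summable_ternary, symmetric])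
  then have "ternary_code (\<lambda>k. B (k + m)) x / 3 ^ m = (\<Sum>k. indicator (B (k + m)) x * (2 / 3 ^ Suc (k + m)))"
    by (simp add: power_add mult.assoc)
  then show ?thesis
    unfolding ternary_code_def
    using suminf_split_initial_segment[OF summable_ternary[of B x], of m] by simp
qed

text \<open>If \<open>k\<close> is the first digit at which the codes differ, that digit contributes
  \<open>2 / 3 ^ Suc k\<close> and the remainders can cancel at most \<open>1 / 3 ^ Suc k\<close> of
  it. Strong induction supplies the agreement of the earlier digits.\<close>

lemma ternary_code_close:
  assumes "\<bar>ternary_code B x - ternary_code B y\<bar> < 1 / 3 ^ Suc m" and "k \<le> m"
  shows "x \<in> B k \<longleftrightarrow> y \<in> B k"
  using assms
proof (induction k rule: less_induct)
  case (less k)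
  then have eq: "(\<Sum>i<k. indicator (B i) x * (2 / 3 ^ Suc i) :: real) =
      (\<Sum>i<k. indicator (B i) y * (2 / 3 ^ Suc i))"
    by (intro sum.cong) (auto simp: indicator_def)
  define X where "X = ternary_code (\<lambda>i. B (i + Suc k)) x"
  define Y where "Y = ternary_code (\<lambda>i. B (i + Suc k)) y"
  have b: "0 \<le> X" "X \<le> 1" "0 \<le> Y" "Y \<le> 1"
    using ternary_code_bounds[of "\<lambda>i. B (i + Suc k)"] unfolding X_def Y_def by auto
  have d: "ternary_code B x - ternary_code B y =
      ((indicator (B k) x - indicator (B k) y) * 2 + (X - Y)) / 3 ^ Suc k"
    using eq unfolding ternary_code_split[of B x "Suc k"] ternary_code_split[of B y "Suc k"] X_def Y_def
    by (simp add: field_simps)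
  have "(1::real) / 3 ^ Suc m \<le> 1 / 3 ^ Suc k"
    using less.prems by (intro divide_left_mono power_increasing) auto
  then have "\<bar>ternary_code B x - ternary_code B y\<bar> < 1 / 3 ^ Suc k"
    using less.prems by linarith
  then have "\<bar>(indicator (B k) x - indicator (B k) y) * 2 + (X - Y)\<bar> < (1::real)"
    unfolding d abs_divide by (simp add: divide_less_cancel)
  then show ?case using b by (cases "x \<in> B k"; cases "y \<in> B k") auto
qed

text \<open>With \<open>B\<close> enumerating a countable basis, the code is in general only Borel,
  but its inverse on the image of \<open>X\<close> is uniformly continuous. By completeness the
  inverse extends to the closure of the image, and closedness of \<open>X\<close> keeps its values
  in \<open>X\<close>.\<close>

lemma ternary_code_inverse:
  fixes X :: "'a::{complete_space, second_countable_topology} set"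
  assumes X: "compact X"
  obtains B g where "\<And>k. open (B k)" "continuous_on (closure (ternary_code B ` X)) g"
    "\<And>x. x \<in> X \<Longrightarrow> g (ternary_code B x) = x" "g ` closure (ternary_code B ` X) \<subseteq> X"
proof -
  obtain \<B> :: "'a set set" where \<B>: "countable \<B>" "topological_basis \<B>"
    using ex_countable_basis by blast
  then have "\<B> \<noteq> {}"
    by (metis UNIV_not_empty Union_empty open_UNIV subset_empty topological_basis_def)
  define B where "B = from_nat_into \<B>"
  have rB: "range B = \<B>" unfolding B_def using \<B> \<open>\<B> \<noteq> {}\<close> by (simp add: range_from_nat_into)
  let ?s = "ternary_code B"
  have sep: "\<exists>m. \<forall>x\<in>X. \<forall>y\<in>X. (\<forall>k\<le>m. x \<in> B k \<longleftrightarrow> y \<in> B k) \<longrightarrow> dist x y < e" if "e > 0" for e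
  proof -
    \<comment> \<open>By compactness finitely many basic sets, each inside a ball of radius
      \<open>e/2\<close>, cover \<open>X\<close>. Two points whose digits agree up to the largest
      index used lie in a common one of them.\<close>
    define I where "I = {k. B k \<noteq> {} \<and> (\<exists>z. B k \<subseteq> ball z (e/2))}"
    have "X \<subseteq> (\<Union>k\<in>I. B k)"
    proof
      fix x assume "x \<in> X"
      obtain U where "U \<in> \<B>" "x \<in> U" "U \<subseteq> ball x (e/2)"
        using topological_basisE[OF \<B>(2), of "ball x (e/2)" x] \<open>e > 0\<close> by auto
      moreover from \<open>U \<in> \<B>\<close> obtain k where "U = B k" using rB by auto
      ultimately show "x \<in> (\<Union>k\<in>I. B k)" unfolding I_def by blast
    qed
    moreover have "open (B k)" for k using rB topological_basis_open[OF \<B>(2)] by auto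
    ultimately obtain J where J: "J \<subseteq> I" "finite J" "X \<subseteq> (\<Union>k\<in>J. B k)"
      using compactE_image[OF X, of I B] by metis
    show ?thesis
    proof (intro exI ballI impI)
      fix x y assume "x \<in> X" "y \<in> X" and agree: "\<forall>k\<le>Max J. x \<in> B k \<longleftrightarrow> y \<in> B k"
      then obtain k where k: "k \<in> J" "x \<in> B k" using J by auto
      then have "y \<in> B k" using agree J(2) by auto
      moreover obtain z where "B k \<subseteq> ball z (e/2)" using k J(1) unfolding I_def by auto
      ultimately have "dist z x < e/2" "dist z y < e/2" using k by auto
      then show "dist x y < e" using dist_triangle_half_r by metis
    qed
  qed
  have close: "\<exists>d>0. \<forall>x\<in>X. \<forall>y\<in>X. \<bar>?s x - ?s y\<bar> < d \<longrightarrow> dist x y < e" if "e > 0" for e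
  proof -
    obtain m where m: "\<And>x y. x \<in> X \<Longrightarrow> y \<in> X \<Longrightarrow> (\<forall>k\<le>m. x \<in> B k \<longleftrightarrow> y \<in> B k) \<Longrightarrow> dist x y < e"
      using sep[OF \<open>e > 0\<close>] by blast
    have "dist x y < e" if "x \<in> X" "y \<in> X" "\<bar>?s x - ?s y\<bar> < 1 / 3 ^ Suc m" for x y
      using m[OF that(1,2)] ternary_code_close[OF that(3)] by blast
    then show ?thesis by (intro exI[of _ "1 / 3 ^ Suc m"]) auto
  qed
  have inj: "inj_on ?s X"
  proof (rule inj_onI, rule ccontr)
    fix x y assume "x \<in> X" "y \<in> X" "?s x = ?s y" "x \<noteq> y"
    then show False using close[of "dist x y"] by force
  qed
  let ?g = "inv_into X ?s"
  have uc: "uniformly_continuous_on (?s ` X) ?g"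
    unfolding uniformly_continuous_on_def
  proof (intro allI impI)
    fix e :: real assume "e > 0"
    from close[OF this] obtain d where "d > 0" "\<forall>x\<in>X. \<forall>y\<in>X. \<bar>?s x - ?s y\<bar> < d \<longrightarrow> dist x y < e" by blast
    then show "\<exists>d>0. \<forall>x\<in>?s ` X. \<forall>x'\<in>?s ` X. dist x' x < d \<longrightarrow> dist (?g x') (?g x) < e"
      using inj by (intro exI[of _ d]) (auto simp: dist_real_def)
  qed
  obtain g where g: "uniformly_continuous_on (closure (?s ` X)) g" "\<And>r. r \<in> ?s ` X \<Longrightarrow> ?g r = g r"
    using uniformly_continuous_on_extension_on_closure[OF uc] by metis
  show thesis
  proof (rule that)
    show "open (B k)" for k using rB topological_basis_open[OF \<B>(2)] by auto
    show cont: "continuous_on (closure (?s ` X)) g" using g(1) by (rule uniformly_continuous_imp_continuous)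
    show gs: "g (?s x) = x" if "x \<in> X" for x using g(2)[of "?s x"] inj that by simp
    show "g ` closure (?s ` X) \<subseteq> X"
      by (rule image_closure_subset[OF cont]) (use gs X compact_imp_closed in auto)
  qed
qed

section \<open>Convergent subsequences by Helly selection\<close>

lemma prob_space_integrable_continuous:
  fixes h :: "'a::topological_space \<Rightarrow> real"
  assumes "compact X" "continuous_on X h" "prob_space N" "sets N = sets (restrict_space borel X)"
  shows "integrable N h"
proof -
  interpret prob_space N by fact
  have sp: "space N = X" using sets_eq_imp_space_eq[OF assms(4)] by (simp add: space_restrict_space)
  obtain b where "\<And>x. x \<in> X \<Longrightarrow> norm (h x) \<le> b"
    using compact_imp_bounded[OF compact_continuous_image[OF assms(2,1)]] by (auto simp: bounded_iff)
  moreover have "h \<in> borel_measurable N"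
    using borel_measurable_continuous_on_restrict[OF assms(2)] assms(4) measurable_cong_sets by blast
  ultimately show ?thesis by (intro integrable_const_bound[of _ b]) (auto simp: sp)
qed

text \<open>The measures are pushed to the line by the code \<open>s\<close>, a weak limit
  \<open>M\<close> is extracted there, and \<open>M\<close> is pulled back by the continuous inverse
  \<open>g\<close>. Since \<open>s\<close> need not be continuous, a test function \<open>h\<close>
  is transferred through \<open>h \<circ> g\<close> rather than through \<open>s\<close>.\<close>

theorem prob_seq_compact:
  fixes X :: "'a::{complete_space, second_countable_topology} set" and N :: "nat \<Rightarrow> 'a measure"
  assumes X: "compact X" and pN: "\<And>n. prob_space (N n)"
    and sN: "\<And>n. sets (N n) = sets (restrict_space borel X)"
  obtains r L where "strict_mono r" "prob_space L" "sets L = sets (restrict_space borel X)"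
    "\<And>h::'a \<Rightarrow> real. continuous_on X h \<Longrightarrow> (\<lambda>n. integral\<^sup>L (N (r n)) h) \<longlonglongrightarrow> integral\<^sup>L L h"
proof -
  have sp: "space (N n) = X" for n using sets_eq_imp_space_eq[OF sN] by (simp add: space_restrict_space)
  obtain B g where B: "\<And>k. open (B k)" and g: "continuous_on (closure (ternary_code B ` X)) g"
    "\<And>x. x \<in> X \<Longrightarrow> g (ternary_code B x) = x" "g ` closure (ternary_code B ` X) \<subseteq> X"
    using ternary_code_inverse[OF X] by blast
  define s where "s = ternary_code B"
  define C where "C = closure (s ` X)"
  have C: "closed C" "continuous_on C g" "g ` C \<subseteq> X" using g unfolding C_def s_def by auto
  have sC: "s x \<in> C" "g (s x) = x" if "x \<in> X" for x
    using that g(2) closure_subset unfolding C_def s_def by blast+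
  have s_meas: "s \<in> borel_measurable (N n)" for n
  proof -
    have "s \<in> borel_measurable borel"
      unfolding s_def using B by (intro ternary_code_measurable borel_open)
    then have "s \<in> borel_measurable (restrict_space borel X)" by (rule measurable_restrict_space1)
    then show ?thesis using sN measurable_cong_sets by blast
  qed
  define \<nu> where "\<nu> n = distr (N n) borel s" for n
  have rd: "real_distribution (\<nu> n)" for n
    unfolding \<nu>_def using pN s_meas by (intro prob_space.real_distribution_distr) auto
  have "tight \<nu>"
    unfolding tight_def
  proof (intro conjI allI impI rd)
    fix e :: real assume "e > 0"
    \<comment> \<open>All codes lie in the unit interval, so one half-open interval containing it
      carries the whole mass of every \<open>\<nu> n\<close>.\<close>
    have "measure (\<nu> n) {-1<..2} = 1" for n
    proof -
      have "measure (\<nu> n) {-1<..2} = measure (N n) (s -` {-1<..2} \<inter> space (N n))"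
        unfolding \<nu>_def by (intro measure_distr s_meas) auto
      also have "s -` {-1<..2} \<inter> space (N n) = space (N n)"
      proof -
        have "-1 < s x" "s x \<le> 2" for x using ternary_code_bounds[of B x] unfolding s_def by linarith+
        then show ?thesis by auto
      qed
      finally show ?thesis using prob_space.prob_space[OF pN[of n]] by simp
    qed
    then show "\<exists>a b. a < b \<and> (\<forall>n. 1 - e < measure (\<nu> n) {a<..b})"
      using \<open>e > 0\<close> by (intro exI[of _ "-1"] exI[of _ "2"]) auto
  qed
  from tight_imp_convergent_subsubsequence[OF this strict_mono_id]
  obtain r M where r: "strict_mono r" and M: "real_distribution M" and wc: "weak_conv_m (\<nu> \<circ> r) M"
    by (auto simp: comp_def)
  interpret M: real_distribution M by fact
  have conv: "(\<lambda>n. integral\<^sup>L (N (r n)) (\<lambda>x. H (s x))) \<longlonglongrightarrow> integral\<^sup>L M H"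
    if H: "continuous_on UNIV H" "\<And>x. norm (H x) \<le> b" for H :: "real \<Rightarrow> real" and b
  proof -
    have [measurable]: "H \<in> borel_measurable borel" using H(1) by (rule borel_measurable_continuous_onI)
    have "(\<lambda>n. integral\<^sup>L ((\<nu> \<circ> r) n) H) \<longlonglongrightarrow> integral\<^sup>L M H"
      using H rd by (intro weak_conv_imp_integral_bdd_continuous_conv[OF _ M wc, where B = b])
        (auto simp: continuous_on_eq_continuous_at)
    then show ?thesis unfolding \<nu>_def comp_def by (simp add: integral_distr[OF s_meas])
  qed
  have ne: "X \<noteq> {}" using prob_space.not_empty[OF pN[of 0]] sp by simp
  have AE_C: "AE x in M. x \<in> C"
  proof -
    \<comment> \<open>The truncated distance to \<open>C\<close> is bounded and continuous and
      vanishes at every code. Its integral against the limit is therefore 0, which puts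
      \<open>M\<close> on the closed set \<open>C\<close>.\<close>
    let ?d = "\<lambda>x. min 1 (infdist x C)"
    have cont: "continuous_on UNIV ?d" by (intro continuous_intros)
    have bd: "norm (?d x) \<le> 1" for x by (simp add: infdist_nonneg)
    have "(\<integral>x. ?d (s x) \<partial>N n) = 0" for n
      by (rule integral_eq_zero_AE) (auto simp: sp sC)
    then have "integral\<^sup>L M ?d = 0"
      using conv[OF cont bd] by (simp add: LIMSEQ_const_iff)
    moreover have "integrable M ?d"
      using bd borel_measurable_continuous_onI[OF cont] by (intro M.integrable_const_bound[of _ 1]) auto
    ultimately have "AE x in M. ?d x = 0"
      by (subst (asm) integral_nonneg_eq_0_iff_AE) (auto simp: infdist_nonneg)
    then show ?thesis
    proof (eventually_elim)
      case (elim x)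
      have "C \<noteq> {}" using ne sC by auto
      then show ?case using elim C(1) by (simp add: in_closed_iff_infdist_zero min_def split: if_splits)
    qed
  qed
  obtain x0 where x0: "x0 \<in> X" using ne by blast
  \<comment> \<open>The default \<open>x0\<close> makes \<open>g'\<close> a total map into
    \<open>X\<close>; it is taken only off \<open>C\<close>, on a null set of
    \<open>M\<close>.\<close>
  define g' where "g' x = (if x \<in> C then g x else x0)" for x
  have g'_meas: "g' \<in> measurable M (restrict_space borel X)"
  proof (rule measurable_restrict_space2)
    show "g' \<in> space M \<rightarrow> X" using C(3) x0 by (auto simp: g'_def image_subset_iff)
    have "g' \<in> borel_measurable borel" unfolding g'_def
      using C by (intro borel_measurable_continuous_on_if) auto
    then show "g' \<in> borel_measurable M" by simp
  qed
  define L where "L = distr M (restrict_space borel X) g'"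
  show thesis
  proof (rule that[OF r])
    show "prob_space L" unfolding L_def by (intro M.prob_space_distr g'_meas)
    show "sets L = sets (restrict_space borel X)" unfolding L_def by simp
    fix h :: "'a \<Rightarrow> real" assume h: "continuous_on X h"
    obtain b where b: "\<And>x. x \<in> X \<Longrightarrow> norm (h x) \<le> b"
      using compact_imp_bounded[OF compact_continuous_image[OF h X]] by (auto simp: bounded_iff)
    have "0 \<le> b" using b[OF x0] norm_ge_zero order_trans by blast
    \<comment> \<open>Weak convergence tests only bounded continuous functions on the whole line, so
      \<open>h \<circ> g\<close> is extended from \<open>C\<close> by Tietze's theorem with the same
      bound.\<close>
    have "continuous_on C (h \<circ> g)"
      using C h by (intro continuous_on_compose) (auto intro: continuous_on_subset)
    then obtain H where H: "continuous_on UNIV H" "\<And>x. x \<in> C \<Longrightarrow> H x = (h \<circ> g) x" "\<And>x. norm (H x) \<le> b"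
      using Tietze[of C "h \<circ> g" UNIV b] C b \<open>0 \<le> b\<close> by (auto simp: image_subset_iff)
    have "integral\<^sup>L L h = (\<integral>x. h (g' x) \<partial>M)" unfolding L_def
      by (rule integral_distr[OF g'_meas borel_measurable_continuous_on_restrict[OF h]])
    also have "\<dots> = integral\<^sup>L M H"
    proof (rule integral_cong_AE)
      show "(\<lambda>x. h (g' x)) \<in> borel_measurable M"
        by (rule measurable_compose[OF g'_meas borel_measurable_continuous_on_restrict[OF h]])
      show "H \<in> borel_measurable M" using borel_measurable_continuous_onI[OF H(1)] by simp
      show "AE x in M. h (g' x) = H x" using AE_C by eventually_elim (simp add: g'_def H)
    qed
    finally have "integral\<^sup>L L h = integral\<^sup>L M H" .
    moreover have "integral\<^sup>L (N n) h = (\<integral>x. H (s x) \<partial>N n)" for n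
      by (intro Bochner_Integration.integral_cong) (auto simp: sp sC H)
    ultimately show "(\<lambda>n. integral\<^sup>L (N (r n)) h) \<longlonglongrightarrow> integral\<^sup>L L h"
      using conv[OF H(1,3)] by simp
  qed
qed

section \<open>A countable family of continuous functions determining a measure\<close>

text \<open>The truncated multiples \<open>min 1 (m * infdist x (- U))\<close> of the distance to
  the complement tend to the indicator of a proper open set \<open>U\<close>. Letting
  \<open>U\<close> run through a countable intersection-stable basis fixes the measure on a
  generator of the Borel sets.\<close>

lemma countable_determining_family:
  obtains v :: "nat \<Rightarrow> 'a::{metric_space, second_countable_topology} \<Rightarrow> real"
  where "\<And>i. continuous_on UNIV (v i)"
    "\<And>X M N. compact X \<Longrightarrow> prob_space M \<Longrightarrow> prob_space N \<Longrightarrow>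
       sets M = sets (restrict_space borel X) \<Longrightarrow> sets N = sets (restrict_space borel X) \<Longrightarrow>
       (\<And>i. integral\<^sup>L M (v i) = integral\<^sup>L N (v i)) \<Longrightarrow> M = N"
proof -
  obtain \<B> :: "'a set set" where \<B>: "countable \<B>" "topological_basis \<B>"
    using ex_countable_basis by blast
  \<comment> \<open>Finite intersections of basic sets are still countably many and are closed under
    intersection; the empty intersection adds \<open>UNIV\<close>.\<close>
  define \<U> where "\<U> = Inter ` {b. finite b \<and> b \<subseteq> \<B>}"
  have c\<U>: "countable \<U>" unfolding \<U>_def by (intro countable_image countable_Collect_finite_subset \<B>)
  have UNIV_\<U>: "UNIV \<in> \<U>" unfolding \<U>_def by (intro image_eqI[of _ _ "{}"]) auto
  have open_\<U>: "open U" if "U \<in> \<U>" for U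
    using that topological_basis_open[OF \<B>(2)] unfolding \<U>_def by (auto intro!: open_Inter)
  have Int_\<U>: "U \<inter> V \<in> \<U>" if "U \<in> \<U>" "V \<in> \<U>" for U V
  proof -
    obtain a b where "U = \<Inter>a" "V = \<Inter>b" "finite a" "finite b" "a \<subseteq> \<B>" "b \<subseteq> \<B>"
      using \<open>U \<in> \<U>\<close> \<open>V \<in> \<U>\<close> unfolding \<U>_def by auto
    then show ?thesis unfolding \<U>_def by (intro image_eqI[of _ _ "a \<union> b"]) auto
  qed
  have \<B>\<U>: "\<B> \<subseteq> \<U>"
  proof
    fix U assume "U \<in> \<B>"
    then show "U \<in> \<U>" unfolding \<U>_def by (intro image_eqI[of _ _ "{U}"]) auto
  qed
  then have "topological_basis \<U>"
    using \<B>(2) open_\<U> unfolding topological_basis_def by (meson order_trans)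
  then have borel_\<U>: "(borel :: 'a measure) = sigma UNIV \<U>" by (rule borel_eq_countable_basis[OF c\<U>])
  define w where "w p x = min 1 (real (snd p) * infdist x (- fst p))" for p :: "'a set \<times> nat" and x
  define v where "v i = w (from_nat_into (\<U> \<times> UNIV) i)" for i
  have w_cont: "continuous_on UNIV (w p)" for p unfolding w_def by (intro continuous_intros)
  have w_v: "\<exists>i. w (U, m) = v i" if "U \<in> \<U>" for U m
  proof -
    have "countable (\<U> \<times> (UNIV :: nat set))" using c\<U> by auto
    then obtain i where "from_nat_into (\<U> \<times> (UNIV :: nat set)) i = (U, m)"
      using from_nat_into_surj[of "\<U> \<times> (UNIV :: nat set)" "(U, m)"] \<open>U \<in> \<U>\<close> by auto
    then show ?thesis unfolding v_def by metis
  qed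
  show thesis
  proof (rule that)
    show "continuous_on UNIV (v i)" for i unfolding v_def by (rule w_cont)
    fix X :: "'a set" and M N :: "'a measure"
    assume X: "compact X" and p: "prob_space M" "prob_space N"
      and s: "sets M = sets (restrict_space borel X)" "sets N = sets (restrict_space borel X)"
      and eq: "\<And>i. integral\<^sup>L M (v i) = integral\<^sup>L N (v i)"
    have cX: "closed X" using X by (rule compact_imp_closed)
    have lim: "(\<lambda>m. integral\<^sup>L R (w (U, m))) \<longlonglongrightarrow> measure R (U \<inter> X)"
      if "U \<in> \<U>" "U \<noteq> UNIV" "prob_space R" "sets R = sets (restrict_space borel X)" for U R
    proof -
      interpret prob_space R by fact
      have sp: "space R = X" using sets_eq_imp_space_eq[OF that(4)] by (simp add: space_restrict_space)
      have U: "U \<inter> X \<in> sets R" using open_\<U>[OF that(1)] that(4) cX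
        by (simp add: sm_sets_iff flip: sm_sets_def)
      have "(\<lambda>m. integral\<^sup>L R (w (U, m))) \<longlonglongrightarrow> integral\<^sup>L R (indicator (U \<inter> X))"
      proof (rule integral_dominated_convergence[where w = "\<lambda>_. 1"])
        show "w (U, m) \<in> borel_measurable R" for m
          using borel_measurable_continuous_on_restrict[OF continuous_on_subset[OF w_cont]] that(4) measurable_cong_sets
          by (metis subset_UNIV)
        show "AE x in R. norm (w (U, m) x) \<le> 1" for m by (simp add: w_def infdist_nonneg)
        show "AE x in R. (\<lambda>m. w (U, m) x) \<longlonglongrightarrow> indicator (U \<inter> X) x"
        proof (rule AE_I2)
          fix x assume "x \<in> space R"
          then have "x \<in> X" using sp by simp
          show "(\<lambda>m. w (U, m) x) \<longlonglongrightarrow> indicator (U \<inter> X) x"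
          proof (cases "x \<in> U")
            case True
            have "closed (- U)" "- U \<noteq> {}" using open_\<U>[OF that(1)] that(2) by auto
            then have d: "infdist x (- U) > 0"
              using True infdist_nonneg[of x "- U"] in_closed_iff_infdist_zero[of "- U" x] by (simp add: order_less_le)
            obtain m0 where m0: "1 \<le> real m0 * infdist x (- U)"
              using reals_Archimedean3[OF d] less_imp_le by metis
            have "eventually (\<lambda>m. w (U, m) x = 1) sequentially"
              using eventually_ge_at_top[of m0]
            proof eventually_elim
              case (elim m)
              then have "real m0 * infdist x (- U) \<le> real m * infdist x (- U)" using d by (intro mult_right_mono) auto
              then show ?case using m0 unfolding w_def by simp
            qed
            then show ?thesis using True \<open>x \<in> X\<close> by (simp add: tendsto_eventually)
          next
            case False
            then show ?thesis by (simp add: w_def)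
          qed
        qed
      qed (use U in auto)
      then show ?thesis using U by simp
    qed
    \<comment> \<open>\<open>U = UNIV\<close> is treated apart: the distance to the empty complement
      is 0 by convention, so the approximating functions vanish. There both measures have total mass
      1.\<close>
    have eqU: "measure M (U \<inter> X) = measure N (U \<inter> X)" if "U \<in> \<U>" for U
    proof (cases "U = UNIV")
      case True
      have "space M = X" "space N = X" using s[THEN sets_eq_imp_space_eq] by (auto simp: space_restrict_space)
      then show ?thesis using True p[THEN prob_space.prob_space] by simp
    next
      case False
      have "integral\<^sup>L M (w (U, m)) = integral\<^sup>L N (w (U, m))" for m
        using w_v[OF that, of m] eq by auto
      then show ?thesis using lim[OF that False p(1) s(1)] lim[OF that False p(2) s(2)]
        by (auto intro: LIMSEQ_unique)
    qed
    interpret M: prob_space M by fact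
    interpret N: prob_space N by fact
    have sets_sigma: "sets (restrict_space borel X) = sigma_sets X ((\<inter>) X ` \<U>)"
    proof -
      have "X \<in> sigma_sets UNIV \<U>" using borel_closed[OF cX] unfolding borel_\<U> by simp
      then show ?thesis unfolding sets_restrict_space borel_\<U> by (simp add: sigma_sets_Int)
    qed
    show "M = N"
    proof (rule measure_eqI_generator_eq[where E = "(\<inter>) X ` \<U>" and \<Omega> = X and A = "\<lambda>_. X"])
      show "Int_stable ((\<inter>) X ` \<U>)"
      proof (rule Int_stableI_image)
        fix U V assume "U \<in> \<U>" "V \<in> \<U>"
        then show "\<exists>W\<in>\<U>. X \<inter> U \<inter> (X \<inter> V) = X \<inter> W" using Int_\<U> by (intro bexI[of _ "U \<inter> V"]) auto
      qed
      show "emeasure M Y = emeasure N Y" if "Y \<in> (\<inter>) X ` \<U>" for Y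
        using that eqU by (auto simp: M.emeasure_eq_measure N.emeasure_eq_measure Int_commute)
      show "range (\<lambda>_::nat. X) \<subseteq> (\<inter>) X ` \<U>" using UNIV_\<U> by (auto intro!: image_eqI[of _ _ UNIV])
    qed (auto simp: s sets_sigma)
  qed
qed

section \<open>A finite minimax theorem\<close>

text \<open>Ky Fan's substitute for convexity: one point must serve all indices at once, and
  \<open>A\<close> needs no linear structure. Here \<open>A\<close> will be a set of set
  functions.\<close>

definition convexlike_on :: "'c set \<Rightarrow> 'i set \<Rightarrow> ('i \<Rightarrow> 'c \<Rightarrow> real) \<Rightarrow> bool" where
  "convexlike_on A I f \<longleftrightarrow> (\<forall>x\<in>A. \<forall>y\<in>A. \<forall>a\<ge>0. \<forall>b\<ge>0. a + b = 1 \<longrightarrow>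
     (\<exists>z\<in>A. \<forall>i\<in>I. f i z \<le> a * f i x + b * f i y))"

text \<open>In the plane, a line separates the points above the range of \<open>(f, g)\<close> from
  the open quadrant below \<open>(t, t)\<close>. Its normal has coordinates of one sign, and
  normalising it gives the weights.\<close>

lemma convexlike_two:
  fixes f g :: "'c \<Rightarrow> real"
  assumes conv: "\<And>x y a b. x \<in> A \<Longrightarrow> y \<in> A \<Longrightarrow> 0 \<le> a \<Longrightarrow> 0 \<le> b \<Longrightarrow> a + b = 1 \<Longrightarrow>
      \<exists>z\<in>A. f z \<le> a * f x + b * f y \<and> g z \<le> a * g x + b * g y"
    and ge: "\<And>x. x \<in> A \<Longrightarrow> t \<le> f x \<or> t \<le> g x"
  obtains a b where "0 \<le> a" "0 \<le> b" "a + b = 1" "\<And>x. x \<in> A \<Longrightarrow> t \<le> a * f x + b * g x"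
proof (cases "A = {}")
  case True
  then show ?thesis using that[of 1 0] by simp
next
  case False
  \<comment> \<open>The range of \<open>(f, g)\<close> need not be convex; its upward closure is, by
    \<open>conv\<close>. Disjointness from \<open>T\<close> is the assumption
    \<open>ge\<close>.\<close>
  define S where "S = {p. \<exists>x\<in>A. f x \<le> fst p \<and> g x \<le> snd p}"
  define T where "T = {..<t} \<times> {..<t}"
  have "convex S"
  proof (rule convexI)
    fix p q u v assume "p \<in> S" "q \<in> S" and uv: "0 \<le> u" "0 \<le> v" "u + v = (1::real)"
    then obtain x y where xy: "x \<in> A" "f x \<le> fst p" "g x \<le> snd p" "y \<in> A" "f y \<le> fst q" "g y \<le> snd q"
      unfolding S_def by auto
    obtain z where "z \<in> A" "f z \<le> u * f x + v * f y" "g z \<le> u * g x + v * g y"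
      using conv[OF xy(1,4) uv] by auto
    moreover have "u * f x + v * f y \<le> u * fst p + v * fst q" "u * g x + v * g y \<le> u * snd p + v * snd q"
      using uv xy by (auto intro!: add_mono mult_left_mono)
    ultimately show "u *\<^sub>R p + v *\<^sub>R q \<in> S" unfolding S_def by (auto intro!: bexI[of _ z])
  qed
  moreover have "convex T" unfolding T_def by (intro convex_Times) auto
  moreover have "S \<noteq> {}" using False unfolding S_def by auto
  moreover have "T \<noteq> {}" unfolding T_def by auto
  moreover have "S \<inter> T = {}" using ge unfolding S_def T_def by force
  ultimately obtain c d where c: "c \<noteq> 0" "\<forall>p\<in>S. c \<bullet> p \<le> d" "\<forall>p\<in>T. d \<le> c \<bullet> p"
    using separating_hyperplane_sets[of S T] by auto
  obtain c1 c2 where c12: "c = (c1, c2)" by (cases c)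
  obtain x0 where x0: "x0 \<in> A" using False by blast
  have up: "c1 * p + c2 * q \<le> d" if "x \<in> A" "f x \<le> p" "g x \<le> q" for x p q
    using bspec[OF c(2), of "(p, q)"] that unfolding S_def c12 by auto
  have "c1 \<le> 0"
  proof (rule ccontr)
    assume "\<not> c1 \<le> 0"
    \<comment> \<open>\<open>S\<close> is unbounded upwards: moving far enough along the first axis
      would push the functional to at least \<open>d + 1\<close>.\<close>
    then have "c1 * max (f x0) ((d + 1 - c2 * g x0) / c1) \<ge> d + 1 - c2 * g x0"
      by (simp add: field_simps max_def)
    then show False using up[OF x0, of "max (f x0) ((d + 1 - c2 * g x0) / c1)" "g x0"] by simp
  qed
  have "c2 \<le> 0"
  proof (rule ccontr)
    assume "\<not> c2 \<le> 0"
    then have "c2 * max (g x0) ((d + 1 - c1 * f x0) / c2) \<ge> d + 1 - c1 * f x0"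
      by (simp add: field_simps max_def)
    then show False using up[OF x0, of "f x0" "max (g x0) ((d + 1 - c1 * f x0) / c2)"] by simp
  qed
  define s where "s = - c1 - c2"
  have "s > 0" using \<open>c1 \<le> 0\<close> \<open>c2 \<le> 0\<close> c(1) unfolding s_def c12 by (auto simp: zero_prod_def)
  have "d \<le> - s * t"
  proof (rule field_le_epsilon)
    fix e :: real assume "e > 0"
    \<comment> \<open>The points of \<open>T\<close> on the diagonal approach its corner
      \<open>(t, t)\<close>; the shift \<open>e / s\<close> makes the error exactly
      \<open>e\<close>.\<close>
    then have "d \<le> c \<bullet> (t - e / s, t - e / s)"
      using c(3) \<open>s > 0\<close> unfolding T_def by auto
    also have "\<dots> = - s * (t - e / s)" unfolding c12 s_def by (simp add: algebra_simps add_divide_distrib)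
    also have "\<dots> = - s * t + e" using \<open>s > 0\<close> by (simp add: algebra_simps)
    finally show "d \<le> - s * t + e" .
  qed
  show ?thesis
  proof (rule that[of "- c1 / s" "- c2 / s"])
    show "0 \<le> - c1 / s" "0 \<le> - c2 / s" using \<open>c1 \<le> 0\<close> \<open>c2 \<le> 0\<close> \<open>s > 0\<close> by (auto simp: divide_nonpos_pos)
    have "- c1 / s + - c2 / s = (- c1 + - c2) / s" by (simp only: add_divide_distrib)
    also have "- c1 + - c2 = s" unfolding s_def by simp
    finally show "- c1 / s + - c2 / s = 1" using \<open>s > 0\<close> by simp
    fix x assume "x \<in> A"
    then have "c1 * f x + c2 * g x \<le> - s * t" using up[of x "f x" "g x"] \<open>d \<le> - s * t\<close> by auto
    then show "t \<le> - c1 / s * f x + - c2 / s * g x" using \<open>s > 0\<close> by (simp add: field_simps)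
  qed
qed

text \<open>Induction on the index set: a convex combination of the other functions works wherever
  \<open>f j\<close> falls below \<open>t\<close>. Hence at every point of \<open>A\<close> either
  it or \<open>f j\<close> reaches \<open>t\<close>, and \<open>convexlike_two\<close> merges the
  two.\<close>

lemma convexlike_finite:
  fixes f :: "'i \<Rightarrow> 'c \<Rightarrow> real"
  assumes "finite I" "I \<noteq> {}" "convexlike_on A I f" "\<And>x. x \<in> A \<Longrightarrow> \<exists>i\<in>I. t \<le> f i x"
  shows "\<exists>w. (\<forall>i\<in>I. 0 \<le> w i) \<and> sum w I = 1 \<and> (\<forall>x\<in>A. t \<le> (\<Sum>i\<in>I. w i * f i x))"
  using assms
proof (induction I arbitrary: A rule: finite_ne_induct)
  case (singleton i)
  then show ?case by (intro exI[of _ "\<lambda>_. 1"]) auto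
next
  case (insert j I)
  \<comment> \<open>The induction hypothesis is needed only where \<open>f j\<close> fails the bound, and this set is again convexlike.\<close>
  define A' where "A' = {x \<in> A. f j x < t}"
  have "convexlike_on A' I f"
    unfolding convexlike_on_def
  proof (intro ballI allI impI)
    fix x y a b assume xy: "x \<in> A'" "y \<in> A'" and ab: "0 \<le> a" "0 \<le> b" "a + b = (1::real)"
    then obtain z where z: "z \<in> A" "\<forall>i\<in>insert j I. f i z \<le> a * f i x + b * f i y"
      using insert.prems(1) unfolding convexlike_on_def A'_def by blast
    have "a * f j x + b * f j y < t"
      using xy ab convex_bound_lt unfolding A'_def by blast
    then show "\<exists>z\<in>A'. \<forall>i\<in>I. f i z \<le> a * f i x + b * f i y"
      using z unfolding A'_def by force
  qed
  moreover have "\<exists>i\<in>I. t \<le> f i x" if "x \<in> A'" for x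
    using insert.prems(2)[of x] that unfolding A'_def by auto
  ultimately obtain w where w: "\<forall>i\<in>I. 0 \<le> w i" "sum w I = 1" "\<forall>x\<in>A'. t \<le> (\<Sum>i\<in>I. w i * f i x)"
    using insert.IH by blast
  let ?g = "\<lambda>x. \<Sum>i\<in>I. w i * f i x"
  obtain a b where ab: "0 \<le> a" "0 \<le> b" "a + b = 1" "\<And>x. x \<in> A \<Longrightarrow> t \<le> a * f j x + b * ?g x"
  proof (rule convexlike_two[of A "f j" ?g t])
    fix x y and a b :: real assume "x \<in> A" "y \<in> A" "0 \<le> a" "0 \<le> b" "a + b = 1"
    then obtain z where z: "z \<in> A" "\<forall>i\<in>insert j I. f i z \<le> a * f i x + b * f i y"
      using insert.prems(1) unfolding convexlike_on_def by blast
    have "?g z \<le> (\<Sum>i\<in>I. w i * (a * f i x + b * f i y))"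
      using z w(1) by (intro sum_mono mult_left_mono) auto
    also have "\<dots> = a * ?g x + b * ?g y"
      by (simp add: algebra_simps sum.distrib sum_distrib_left)
    finally show "\<exists>z\<in>A. f j z \<le> a * f j x + b * f j y \<and> ?g z \<le> a * ?g x + b * ?g y"
      using z by auto
  next
    show "t \<le> f j x \<or> t \<le> ?g x" if "x \<in> A" for x
      using w(3) that unfolding A'_def by force
  qed blast
  \<comment> \<open>The new index receives \<open>a\<close> and the old weights, of total 1, are
    scaled by \<open>b\<close>, so the sum is \<open>a + b = 1\<close>.\<close>
  let ?w = "\<lambda>i. if i = j then a else b * w i"
  have "(\<Sum>i\<in>I. ?w i * f i x) = b * ?g x" for x
    unfolding sum_distrib_left using insert.hyps by (intro sum.cong) auto
  moreover have "sum ?w I = b * sum w I"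
    unfolding sum_distrib_left using insert.hyps by (intro sum.cong) auto
  ultimately show ?case
    using insert.hyps w ab by (intro exI[of _ ?w]) auto
qed

section \<open>Marginals, mixtures and weak-* limits\<close>

lemma measure_determined:
  fixes M N :: "'a::{metric_space, second_countable_topology} measure"
  assumes "compact X" "prob_space M" "prob_space N"
    "sets M = sets (restrict_space borel X)" "sets N = sets (restrict_space borel X)"
    "\<And>h::'a \<Rightarrow> real. continuous_on X h \<Longrightarrow> integral\<^sup>L M h = integral\<^sup>L N h"
  shows "M = N"
proof -
  obtain v :: "nat \<Rightarrow> 'a \<Rightarrow> real" where "\<And>i. continuous_on UNIV (v i)"
    "\<And>X M N. compact X \<Longrightarrow> prob_space M \<Longrightarrow> prob_space N \<Longrightarrow>
       sets M = sets (restrict_space borel X) \<Longrightarrow> sets N = sets (restrict_space borel X) \<Longrightarrow>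
       (\<And>i. integral\<^sup>L M (v i) = integral\<^sup>L N (v i)) \<Longrightarrow> M = N"
    using countable_determining_family by blast
  then show ?thesis using assms continuous_on_subset subset_UNIV by metis
qed

section \<open>Marginals as image measures\<close>

lemma measurable_proj_restrict:
  fixes K L :: "'a::topological_space set"
  assumes "sets N = sets (restrict_space borel (K \<times> L))"
  shows "fst \<in> measurable N (restrict_space borel K)" "snd \<in> measurable N (restrict_space borel L)"
proof -
  have "fst \<in> measurable (restrict_space borel (K \<times> L)) (restrict_space borel K)"
    by (rule measurable_restrict_space2)
      (auto simp: space_restrict_space intro!: borel_measurable_continuous_on_restrict continuous_intros)
  then show "fst \<in> measurable N (restrict_space borel K)"
    using assms measurable_cong_sets by blast
  have "snd \<in> measurable (restrict_space borel (K \<times> L)) (restrict_space borel L)"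
    by (rule measurable_restrict_space2)
      (auto simp: space_restrict_space intro!: borel_measurable_continuous_on_restrict continuous_intros)
  then show "snd \<in> measurable N (restrict_space borel L)"
    using assms measurable_cong_sets by blast
qed

text \<open>The preimages of \<open>A\<close> under the projections are \<open>A \<times> K\<close>
  and \<open>K \<times> A\<close>. Both sides are 0 off the Borel sets, so they agree as total
  functions.\<close>

lemma marg_measure:
  fixes K :: "'a::topological_space set"
  assumes N: "sets N = sets (restrict_space borel (K \<times> K))"
  shows "fst_marg K (measure N) = measure (distr N (restrict_space borel K) fst)"
    and "snd_marg K (measure N) = measure (distr N (restrict_space borel K) snd)"
proof -
  have sp: "space N = K \<times> K" using sets_eq_imp_space_eq[OF N] by (simp add: space_restrict_space)
  have sub: "A \<subseteq> K" if "A \<in> sm_sets K" for A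
    using that sets.sets_into_space[of A "restrict_space borel K"] by (simp add: sm_sets_def space_restrict_space)
  show "fst_marg K (measure N) = measure (distr N (restrict_space borel K) fst)"
  proof
    fix A show "fst_marg K (measure N) A = measure (distr N (restrict_space borel K) fst) A"
    proof (cases "A \<in> sm_sets K")
      case True
      have "fst -` A \<inter> space N = A \<times> K" using sub[OF True] sp by auto
      then show ?thesis using True measure_distr[OF measurable_proj_restrict(1)[OF N], of A]
        by (simp add: fst_marg_def sm_sets_def)
    next
      case False
      then show ?thesis by (simp add: fst_marg_def sm_sets_def measure_notin_sets)
    qed
  qed
  show "snd_marg K (measure N) = measure (distr N (restrict_space borel K) snd)"
  proof
    fix A show "snd_marg K (measure N) A = measure (distr N (restrict_space borel K) snd) A"
    proof (cases "A \<in> sm_sets K")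
      case True
      have "snd -` A \<inter> space N = K \<times> A" using sub[OF True] sp by auto
      then show ?thesis using True measure_distr[OF measurable_proj_restrict(2)[OF N], of A]
        by (simp add: snd_marg_def sm_sets_def)
    next
      case False
      then show ?thesis by (simp add: snd_marg_def sm_sets_def measure_notin_sets)
    qed
  qed
qed

text \<open>Each marginal is the image measure under a projection, so the integral identities are
  the change of variables formula.\<close>

lemma
  fixes K :: "'a::topological_space set"
  assumes p: "prob_measure_on (K \<times> K) \<pi>"
  shows prob_measure_on_fst_marg: "prob_measure_on K (fst_marg K \<pi>)"
    and prob_measure_on_snd_marg: "prob_measure_on K (snd_marg K \<pi>)"
    and sm_integral_fst_marg: "continuous_on K v \<Longrightarrow>
      sm_integral K (fst_marg K \<pi>) v = sm_integral (K \<times> K) \<pi> (\<lambda>z. v (fst z))"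
    and sm_integral_snd_marg: "continuous_on K v \<Longrightarrow>
      sm_integral K (snd_marg K \<pi>) v = sm_integral (K \<times> K) \<pi> (\<lambda>z. v (snd z))"
proof -
  obtain N where N: "prob_space N" "sets N = sets (restrict_space borel (K \<times> K))" "\<pi> = measure N"
    and int: "\<And>h. sm_integral (K \<times> K) \<pi> h = integral\<^sup>L N h"
    using prob_measure_onE[OF p] by metis
  note meas = measurable_proj_restrict[OF N(2)]
  let ?R = "restrict_space borel K"
  have D: "prob_space (distr N ?R fst)" "prob_space (distr N ?R snd)"
    using prob_space.prob_space_distr[OF N(1)] meas by auto
  show "prob_measure_on K (fst_marg K \<pi>)" "prob_measure_on K (snd_marg K \<pi>)"
    unfolding N(3) marg_measure[OF N(2)] by (intro prob_measure_on_measure D; simp)+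
  assume v: "continuous_on K v"
  show "sm_integral K (fst_marg K \<pi>) v = sm_integral (K \<times> K) \<pi> (\<lambda>z. v (fst z))"
    unfolding int unfolding N(3) marg_measure[OF N(2)]
    using integral_distr[OF meas(1) borel_measurable_continuous_on_restrict[OF v]] D
    by (subst sm_integral_measure) auto
  show "sm_integral K (snd_marg K \<pi>) v = sm_integral (K \<times> K) \<pi> (\<lambda>z. v (snd z))"
    unfolding int unfolding N(3) marg_measure[OF N(2)]
    using integral_distr[OF meas(2) borel_measurable_continuous_on_restrict[OF v]] D
    by (subst sm_integral_measure) auto
qed

section \<open>Mixtures of measures and linearity of the integral\<close>

lemma signed_measure_on_mix:
  assumes "signed_measure_on S \<mu>" "signed_measure_on S \<nu>"
  shows "signed_measure_on S (\<lambda>A. a * \<mu> A + b * \<nu> A)"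
  using assms unfolding signed_measure_on_def by (auto intro!: sums_add sums_mult)

lemma prob_measure_on_mix:
  assumes "prob_measure_on S \<mu>" "prob_measure_on S \<nu>" "0 \<le> a" "0 \<le> b" "a + b = 1"
  shows "prob_measure_on S (\<lambda>A. a * \<mu> A + b * \<nu> A)"
  using assms unfolding prob_measure_on_def by (auto intro!: signed_measure_on_mix)

text \<open>The usual passage from indicators through multiples and sums to monotone limits. The
  mixture enters only through its values on sets, so no sum of measures has to be
  constructed.\<close>

lemma nn_integral_mix:
  assumes s: "sets M = sets R" "sets N = sets R" "f \<in> borel_measurable R"
    and e: "\<And>A. A \<in> sets R \<Longrightarrow> emeasure R A = a * emeasure M A + b * emeasure N A"
  shows "(\<integral>\<^sup>+x. f x \<partial>R) = a * (\<integral>\<^sup>+x. f x \<partial>M) + b * (\<integral>\<^sup>+x. f x \<partial>N)"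
  using s(3)
proof (induction rule: borel_measurable_induct)
  case (cong f g)
  have "space M = space R" "space N = space R" using s(1,2)[THEN sets_eq_imp_space_eq] by auto
  then have "(\<integral>\<^sup>+x. f x \<partial>Q) = (\<integral>\<^sup>+x. g x \<partial>Q)" if "Q \<in> {R, M, N}" for Q
    using that cong(3) by (intro nn_integral_cong) auto
  then show ?case using cong by auto
next
  case (set A)
  then show ?case using e s by simp
next
  case (mult u c)
  then have "u \<in> borel_measurable M" "u \<in> borel_measurable N" using s measurable_cong_sets by blast+
  with mult show ?case by (simp add: nn_integral_cmult algebra_simps)
next
  case (add u v)
  then have "u \<in> borel_measurable M" "u \<in> borel_measurable N" "v \<in> borel_measurable M" "v \<in> borel_measurable N"
    using s measurable_cong_sets by blast+
  with add show ?case by (simp add: nn_integral_add algebra_simps)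
next
  case (seq U)
  have m: "U i \<in> borel_measurable M" "U i \<in> borel_measurable N" for i
    using seq s measurable_cong_sets by blast+
  have inc: "incseq (\<lambda>i. \<integral>\<^sup>+x. U i x \<partial>Q)" for Q
    using \<open>incseq U\<close> by (auto simp: incseq_def le_fun_def intro!: nn_integral_mono)
  have S: "(\<integral>\<^sup>+x. (SUP i. U i) x \<partial>Q) = (SUP i. \<integral>\<^sup>+x. U i x \<partial>Q)" if "\<And>i. U i \<in> borel_measurable Q" for Q
    using nn_integral_monotone_convergence_SUP[OF \<open>incseq U\<close> that] by (simp add: image_comp)
  have "(SUP i. \<integral>\<^sup>+x. U i x \<partial>R) = (SUP i. a * (\<integral>\<^sup>+x. U i x \<partial>M) + b * (\<integral>\<^sup>+x. U i x \<partial>N))"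
    using seq by simp
  also have "\<dots> = (SUP i. a * (\<integral>\<^sup>+x. U i x \<partial>M)) + (SUP i. b * (\<integral>\<^sup>+x. U i x \<partial>N))"
    using inc by (intro ennreal_SUP_add) (auto simp: incseq_def intro!: mult_left_mono)
  finally show ?case
    using S[OF m(1)] S[OF m(2)] S[OF seq(1)] by (simp add: SUP_mult_left_ennreal)
qed

text \<open>Adding a bound \<open>c\<close> of the absolute value of \<open>h\<close> makes the
  integrand nonnegative, so \<open>nn_integral_mix\<close> applies; the constant cancels because
  \<open>a + b = 1\<close>.\<close>

lemma sm_integral_mix:
  fixes h :: "'a::topological_space \<Rightarrow> real"
  assumes S: "compact S" and p: "prob_measure_on S \<mu>" "prob_measure_on S \<nu>"
    and ab: "0 \<le> a" "0 \<le> b" "a + b = 1" and h: "continuous_on S h"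
  shows "sm_integral S (\<lambda>A. a * \<mu> A + b * \<nu> A) h = a * sm_integral S \<mu> h + b * sm_integral S \<nu> h"
proof -
  let ?\<rho> = "\<lambda>A. a * \<mu> A + b * \<nu> A"
  have pr: "prob_measure_on S ?\<rho>" by (rule prob_measure_on_mix[OF p ab])
  let ?R = "sm_pos S ?\<rho>" and ?M = "sm_pos S \<mu>" and ?N = "sm_pos S \<nu>"
  have meas: "h \<in> borel_measurable (sm_pos S \<kappa>)" for \<kappa>
    using borel_measurable_continuous_on_restrict[OF h] sets_sm_pos measurable_cong_sets by blast
  have int: "integrable (sm_pos S \<kappa>) h" if "prob_measure_on S \<kappa>" for \<kappa>
    using prob_space_integrable_continuous[OF S h prob_space_sm_pos[OF that] sets_sm_pos] .
  obtain c where c: "\<And>x. x \<in> S \<Longrightarrow> norm (h x) \<le> c"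
    using compact_imp_bounded[OF compact_continuous_image[OF h S]] by (auto simp: bounded_iff)
  have nn: "(\<integral>\<^sup>+x. ennreal (h x + c) \<partial>sm_pos S \<kappa>) = ennreal (sm_integral S \<kappa> h + c)"
    and pos: "0 \<le> sm_integral S \<kappa> h + c" if k: "prob_measure_on S \<kappa>" for \<kappa>
  proof -
    interpret prob_space "sm_pos S \<kappa>" by (rule prob_space_sm_pos[OF k])
    have ge: "0 \<le> h x + c" if "x \<in> space (sm_pos S \<kappa>)" for x using c[of x] that by (auto simp: space_sm_pos)
    have eq: "(\<integral>x. h x + c \<partial>sm_pos S \<kappa>) = sm_integral S \<kappa> h + c"
      using int[OF k] by (simp add: sm_integral_prob[OF k] prob_space)
    show "(\<integral>\<^sup>+x. ennreal (h x + c) \<partial>sm_pos S \<kappa>) = ennreal (sm_integral S \<kappa> h + c)"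
      unfolding eq[symmetric] using int[OF k] ge by (intro nn_integral_eq_integral) auto
    show "0 \<le> sm_integral S \<kappa> h + c"
      unfolding eq[symmetric] using ge by (intro integral_nonneg_AE AE_I2) auto
  qed
  have "(\<integral>\<^sup>+x. ennreal (h x + c) \<partial>?R) =
      ennreal a * (\<integral>\<^sup>+x. ennreal (h x + c) \<partial>?M) + ennreal b * (\<integral>\<^sup>+x. ennreal (h x + c) \<partial>?N)"
  proof (rule nn_integral_mix)
    fix A assume "A \<in> sets ?R"
    then have "A \<in> sm_sets S" by (simp add: sets_sm_pos sm_sets_def)
    then show "emeasure ?R A = ennreal a * emeasure ?M A + ennreal b * emeasure ?N A"
      using p pr ab by (simp add: emeasure_sm_pos ennreal_mult prob_measure_on_def)
  qed (use meas[of ?\<rho>] in \<open>auto simp: sets_sm_pos\<close>)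
  then have "ennreal (sm_integral S ?\<rho> h + c) =
      ennreal (a * (sm_integral S \<mu> h + c) + b * (sm_integral S \<nu> h + c))"
    using pos[OF p(1)] pos[OF p(2)] ab by (simp add: nn p pr ennreal_mult)
  then have "sm_integral S ?\<rho> h + c = a * (sm_integral S \<mu> h + c) + b * (sm_integral S \<nu> h + c)"
    using pos[OF p(1)] pos[OF p(2)] pos[OF pr] ab by (subst (asm) ennreal_inj) auto
  also have "\<dots> = a * sm_integral S \<mu> h + b * sm_integral S \<nu> h + (a + b) * c"
    by (simp add: algebra_simps)
  finally show ?thesis using ab by simp
qed

lemma sm_integral_sum:
  fixes h :: "'i \<Rightarrow> 'a::topological_space \<Rightarrow> real"
  assumes S: "compact S" and p: "prob_measure_on S \<mu>" and h: "\<And>i. i \<in> I \<Longrightarrow> continuous_on S (h i)"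
  shows "sm_integral S \<mu> (\<lambda>x. \<Sum>i\<in>I. w i * h i x) = (\<Sum>i\<in>I. w i * sm_integral S \<mu> (h i))"
  using prob_space_integrable_continuous[OF S h prob_space_sm_pos[OF p] sets_sm_pos]
  by (simp add: sm_integral_prob[OF p] integral_sum)

lemma sm_integral_cmult:
  "prob_measure_on S \<mu> \<Longrightarrow> sm_integral S \<mu> (\<lambda>x. c * h x) = c * sm_integral S \<mu> h"
  by (simp add: sm_integral_prob)

section \<open>Weak-* limits of sequences of measures\<close>

text \<open>Induction over the generation of the open set from the subbasis. It turns convergence of
  all integrals into convergence in \<open>weak_star S\<close>, so that lower semicontinuity can be
  used along sequences.\<close>

lemma openin_weak_star_seq:
  assumes op: "openin (weak_star S) U" and "\<mu> \<in> U"
    and s: "\<And>n::nat. signed_measure_on S (\<nu> n)"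
    and conv: "\<And>h. continuous_on S h \<Longrightarrow> (\<lambda>n. sm_integral S (\<nu> n) h) \<longlonglongrightarrow> sm_integral S \<mu> h"
  shows "eventually (\<lambda>n. \<nu> n \<in> U) sequentially"
proof -
  have "generate_topology_on {{\<mu>. signed_measure_on S \<mu> \<and> sm_integral S \<mu> h \<in> U} | h U. continuous_on S h \<and> open U} U"
    using op unfolding weak_star_def by (rule openin_topology_generated_by)
  then show ?thesis using \<open>\<mu> \<in> U\<close>
  proof induction
    case (Int a b)
    then show ?case by (auto simp: eventually_conj_iff)
  next
    case (UN \<K>)
    then obtain k where "k \<in> \<K>" "\<mu> \<in> k" by auto
    with UN have "eventually (\<lambda>n. \<nu> n \<in> k) sequentially" by auto
    then show ?case by eventually_elim (use \<open>k \<in> \<K>\<close> in auto)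
  next
    case (Basis B)
    then obtain h V where "B = {\<mu>. signed_measure_on S \<mu> \<and> sm_integral S \<mu> h \<in> V}" "continuous_on S h" "open V"
      by auto
    then show ?case using conv[of h] s Basis.prems by (auto dest!: topological_tendstoD)
  qed auto
qed

text \<open>Compactness comes from \<open>prob_seq_compact\<close> on the product. The marginal
  constraint survives the limit because functions of the first coordinate are admissible test
  functions.\<close>

lemma Pi1_seq_compact:
  fixes K :: "'a::euclidean_space set"
  assumes K: "compact K" and pi: "\<And>n::nat. \<pi> n \<in> Pi1 K P"
  obtains r \<rho> where "strict_mono r" "\<rho> \<in> Pi1 K P"
    "\<And>h. continuous_on (K \<times> K) h \<Longrightarrow>
      (\<lambda>n. sm_integral (K \<times> K) (\<pi> (r n)) h) \<longlonglongrightarrow> sm_integral (K \<times> K) \<rho> h"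
proof -
  have p: "prob_measure_on (K \<times> K) (\<pi> n)" and m: "fst_marg K (\<pi> n) = P" for n
    using pi unfolding Pi1_def by auto
  have KK: "compact (K \<times> K)" by (intro compact_Times K)
  obtain r L where r: "strict_mono r" and L: "prob_space L" "sets L = sets (restrict_space borel (K \<times> K))"
    and lim: "\<And>h::'a \<times> 'a \<Rightarrow> real. continuous_on (K \<times> K) h \<Longrightarrow>
      (\<lambda>n. integral\<^sup>L (sm_pos (K \<times> K) (\<pi> (r n))) h) \<longlonglongrightarrow> integral\<^sup>L L h"
    using prob_seq_compact[where N = "\<lambda>n. sm_pos (K \<times> K) (\<pi> n)", OF KK prob_space_sm_pos[OF p] sets_sm_pos]
    by blast
  have pL: "prob_measure_on (K \<times> K) (measure L)" by (rule prob_measure_on_measure[OF L])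
  have conv: "(\<lambda>n. sm_integral (K \<times> K) (\<pi> (r n)) h) \<longlonglongrightarrow> sm_integral (K \<times> K) (measure L) h"
    if "continuous_on (K \<times> K) h" for h
    using lim[OF that] by (simp add: sm_integral_prob[OF p] sm_integral_measure[OF L])
  have pP: "prob_measure_on K P" using prob_measure_on_fst_marg[OF p[of 0]] m by simp
  have "sm_pos K (fst_marg K (measure L)) = sm_pos K P"
  proof (rule measure_determined[OF K])
    show "prob_space (sm_pos K (fst_marg K (measure L)))" "prob_space (sm_pos K P)"
      using prob_space_sm_pos prob_measure_on_fst_marg[OF pL] pP by auto
    fix u :: "'a \<Rightarrow> real" assume u: "continuous_on K u"
    have "continuous_on (K \<times> K) (\<lambda>z. u (fst z))"
      by (rule continuous_on_compose2[OF u continuous_on_fst[OF continuous_on_id]]) auto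
    from conv[OF this] have "(\<lambda>n. sm_integral K (fst_marg K (\<pi> (r n))) u) \<longlonglongrightarrow> sm_integral K (fst_marg K (measure L)) u"
      by (simp add: sm_integral_fst_marg[OF p u] sm_integral_fst_marg[OF pL u])
    \<comment> \<open>Along the sequence the first marginal is always \<open>P\<close>, so this is
      the limit of a constant sequence.\<close>
    then have "sm_integral K P u = sm_integral K (fst_marg K (measure L)) u"
      by (simp add: m LIMSEQ_const_iff)
    then show "integral\<^sup>L (sm_pos K (fst_marg K (measure L))) u = integral\<^sup>L (sm_pos K P) u"
      using sm_integral_prob[OF pP] sm_integral_prob[OF prob_measure_on_fst_marg[OF pL]] by simp
  qed (simp_all add: sets_sm_pos)
  then have "fst_marg K (measure L) = P"
    using measure_sm_pos[OF pP] measure_sm_pos[OF prob_measure_on_fst_marg[OF pL]] by simp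
  then have "measure L \<in> Pi1 K P" using pL unfolding Pi1_def by simp
  then show thesis using that r conv by blast
qed

section \<open>Strong duality\<close>

text \<open>The hard half of duality, in a form that avoids attainment of the dual supremum. The
  strict inequality in \<open>lb\<close> is what the bound \<open>F \<rho> \<le> ereal t\<close> for
  the limit measure contradicts.\<close>

lemma potential_of_lower_bound:
  fixes K :: "'a::euclidean_space set"
  assumes K: "compact K" and Q: "prob_measure_on K Q"
    and proper: "\<And>\<mu>. signed_measure_on (K \<times> K) \<mu> \<Longrightarrow> F \<mu> \<noteq> -\<infinity>"
    and conv: "sm_convex (K \<times> K) F" and lsc: "weak_star_lsc (K \<times> K) F"
    and lb: "\<And>\<pi>. \<pi> \<in> Pi2 K P Q \<Longrightarrow> ereal t < F \<pi>"
  obtains v where "continuous_on K v" "\<And>\<pi>. \<pi> \<in> Pi1 K P \<Longrightarrow> ereal t \<le> Lag K F Q v \<pi>"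
proof -
  have KK: "compact (K \<times> K)" by (intro compact_Times K)
  have prob: "prob_measure_on (K \<times> K) \<pi>" if "\<pi> \<in> Pi1 K P" for \<pi> using that by (simp add: Pi1_def)
  have signed: "signed_measure_on (K \<times> K) \<pi>" if "\<pi> \<in> Pi1 K P" for \<pi>
    using prob[OF that] by (simp add: prob_measure_on_def)
  have cont_snd: "continuous_on (K \<times> K) (\<lambda>z. u (snd z))" if "continuous_on K u" for u :: "'a \<Rightarrow> real"
    by (rule continuous_on_compose2[OF that continuous_on_snd[OF continuous_on_id]]) auto
  obtain v :: "nat \<Rightarrow> 'a \<Rightarrow> real" where v_cont: "\<And>i. continuous_on UNIV (v i)"
    and v_det: "\<And>X M N. compact X \<Longrightarrow> prob_space M \<Longrightarrow> prob_space N \<Longrightarrow>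
       sets M = sets (restrict_space borel X) \<Longrightarrow> sets N = sets (restrict_space borel X) \<Longrightarrow>
       (\<And>i. integral\<^sup>L M (v i) = integral\<^sup>L N (v i)) \<Longrightarrow> M = N"
    using countable_determining_family by blast
  \<comment> \<open>On \<open>A\<close> the functional is real-valued and the finite minimax theorem
    applies; elsewhere on \<open>Pi1 K P\<close> the Lagrangian is infinite and any lower bound
    holds.\<close>
  define A where "A = {\<pi> \<in> Pi1 K P. F \<pi> < \<infinity>}"
  define f where "f u \<pi> = real_of_ereal (F \<pi>) - sm_integral (K \<times> K) \<pi> (\<lambda>z. u (snd z)) + sm_integral K Q u"
    for u \<pi>
  have F_real: "F \<pi> = ereal (real_of_ereal (F \<pi>))" if "\<pi> \<in> A" for \<pi>
    using that proper[OF signed] unfolding A_def by (cases "F \<pi>") auto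
  have Lag_A: "Lag K F Q u \<pi> = ereal (f u \<pi>)" if "\<pi> \<in> A" "continuous_on K u" for u \<pi>
    using that sm_integral_snd_marg[OF prob that(2), of \<pi>] F_real[OF that(1)]
    unfolding Lag_def f_def A_def by (metis (no_types, lifting) ereal_minus(1) mem_Collect_eq plus_ereal.simps(1))
  have Lag_lb: "ereal t \<le> Lag K F Q u \<pi>"
    if "continuous_on K u" "\<And>\<pi>. \<pi> \<in> A \<Longrightarrow> t \<le> f u \<pi>" "\<pi> \<in> Pi1 K P" for u \<pi>
  proof (cases "\<pi> \<in> A")
    case True
    then show ?thesis using that Lag_A by simp
  next
    case False
    then have "F \<pi> = \<infinity>" using that(3) unfolding A_def by simp
    then show ?thesis unfolding Lag_def by simp
  qed
  \<comment> \<open>Integer multiples of the determining functions; the finite sets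
    \<open>I n\<close> increase to all index pairs. Both signs are included so that the integrals
    against \<open>Q\<close> can be forced to be equal.\<close>
  define W where "W p y = of_int (snd p) * v (fst p) y" for p :: "nat \<times> int" and y
  define I where "I n = {..n} \<times> {- int n..int n}" for n
  have W_cont: "continuous_on K (W p)" for p
    unfolding W_def by (intro continuous_intros continuous_on_subset[OF v_cont]) auto
  have fin: "finite (I n)" "I n \<noteq> {}" for n unfolding I_def by auto
  \<comment> \<open>The Lagrangian is affine in the potential: weights of total 1 reproduce the term
    in \<open>F\<close>.\<close>
  have f_sum: "f (\<lambda>y. \<Sum>p\<in>I n. w p * W p y) \<pi> = (\<Sum>p\<in>I n. w p * f (W p) \<pi>)"
    if "\<pi> \<in> A" "sum w (I n) = 1" for w n \<pi>
  proof -
    have "sm_integral (K \<times> K) \<pi> (\<lambda>z. \<Sum>p\<in>I n. w p * W p (snd z)) =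
        (\<Sum>p\<in>I n. w p * sm_integral (K \<times> K) \<pi> (\<lambda>z. W p (snd z)))"
      using that(1) by (intro sm_integral_sum KK prob cont_snd W_cont) (simp add: A_def)
    moreover have "sm_integral K Q (\<lambda>y. \<Sum>p\<in>I n. w p * W p y) = (\<Sum>p\<in>I n. w p * sm_integral K Q (W p))"
      by (intro sm_integral_sum K Q W_cont)
    moreover have "real_of_ereal (F \<pi>) = (\<Sum>p\<in>I n. w p * real_of_ereal (F \<pi>))"
      using that(2) by (simp flip: sum_distrib_right)
    ultimately show ?thesis unfolding f_def
      by (simp add: algebra_simps sum.distrib sum_subtractf)
  qed
  \<comment> \<open>The mixture of \<open>x\<close> and \<open>y\<close> serves all indices
    simultaneously: \<open>F\<close> is convex and the remaining terms are affine along
    mixtures.\<close>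
  have convexlike: "convexlike_on A (I n) (\<lambda>p. f (W p))" for n
    unfolding convexlike_on_def
  proof (intro ballI allI impI)
    fix x y and a b :: real assume xy: "x \<in> A" "y \<in> A" and ab: "0 \<le> a" "0 \<le> b" "a + b = 1"
    let ?z = "\<lambda>B. a * x B + b * y B"
    have xy1: "x \<in> Pi1 K P" "y \<in> Pi1 K P" using xy by (auto simp: A_def)
    have pz: "prob_measure_on (K \<times> K) ?z" using prob_measure_on_mix[OF prob prob ab] xy1 by auto
    moreover have "fst_marg K ?z = P"
    proof
      fix B
      have "fst_marg K x B = P B" "fst_marg K y B = P B" using xy1 by (auto simp: Pi1_def)
      then have "fst_marg K ?z B = a * P B + b * P B" by (auto simp: fst_marg_def split: if_splits)
      also have "\<dots> = P B" using ab by (simp flip: distrib_right)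
      finally show "fst_marg K ?z B = P B" .
    qed
    ultimately have z1: "?z \<in> Pi1 K P" by (simp add: Pi1_def)
    have b: "b = 1 - a" and "a \<le> 1" using ab by auto
    have "F ?z \<le> ereal a * F x + ereal b * F y"
      using conv signed xy1 ab \<open>a \<le> 1\<close> unfolding sm_convex_def b by blast
    also have "\<dots> = ereal (a * real_of_ereal (F x) + b * real_of_ereal (F y))"
      using F_real[OF xy(1)] F_real[OF xy(2)] by (metis plus_ereal.simps(1) times_ereal.simps(1))
    finally have Fz: "F ?z \<le> ereal (a * real_of_ereal (F x) + b * real_of_ereal (F y))" .
    then have zA: "?z \<in> A" using z1 unfolding A_def by auto
    have F_mix: "real_of_ereal (F ?z) \<le> a * real_of_ereal (F x) + b * real_of_ereal (F y)"
      using Fz by (subst (asm) F_real[OF zA]) simp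
    have "f (W p) ?z \<le> a * f (W p) x + b * f (W p) y" for p
    proof -
      let ?J = "\<lambda>\<mu>. sm_integral (K \<times> K) \<mu> (\<lambda>z. W p (snd z))" and ?q = "sm_integral K Q (W p)"
      have "?J ?z = a * ?J x + b * ?J y"
        using xy1 by (intro sm_integral_mix KK prob ab cont_snd W_cont)
      moreover have "?q = a * ?q + b * ?q" using ab by (simp flip: distrib_right)
      ultimately have "f (W p) ?z \<le> (a * real_of_ereal (F x) + b * real_of_ereal (F y)) -
          (a * ?J x + b * ?J y) + (a * ?q + b * ?q)"
        unfolding f_def using F_mix by linarith
      also have "\<dots> = a * f (W p) x + b * f (W p) y" unfolding f_def by (simp add: algebra_simps)
      finally show ?thesis .
    qed
    then show "\<exists>z\<in>A. \<forall>p\<in>I n. f (W p) z \<le> a * f (W p) x + b * f (W p) y" using zA by blast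
  qed
  have "\<exists>n. \<forall>\<pi>\<in>A. \<exists>p\<in>I n. t \<le> f (W p) \<pi>"
  proof (rule ccontr)
    assume "\<not> ?thesis"
    then have "\<forall>n. \<exists>\<pi>\<in>A. \<forall>p\<in>I n. f (W p) \<pi> < t" by (meson not_le)
    then obtain \<pi> where piA: "\<And>n. \<pi> n \<in> A" and pi_lt: "\<And>n p. p \<in> I n \<Longrightarrow> f (W p) (\<pi> n) < t"
      by metis
    then have pi1: "\<pi> n \<in> Pi1 K P" for n by (simp add: A_def)
    obtain r \<rho> where r: "strict_mono r" and rho: "\<rho> \<in> Pi1 K P" and
      lim: "\<And>h. continuous_on (K \<times> K) h \<Longrightarrow>
        (\<lambda>n. sm_integral (K \<times> K) (\<pi> (r n)) h) \<longlonglongrightarrow> sm_integral (K \<times> K) \<rho> h"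
      using Pi1_seq_compact[where \<pi> = \<pi>, OF K pi1] by metis
    have F_le: "F \<rho> \<le> ereal (t + sm_integral (K \<times> K) \<rho> (\<lambda>z. W p (snd z)) - sm_integral K Q (W p))" for p
    proof (rule ccontr)
      let ?J = "\<lambda>\<mu>. t + sm_integral (K \<times> K) \<mu> (\<lambda>z. W p (snd z)) - sm_integral K Q (W p)"
      assume "\<not> F \<rho> \<le> ereal (?J \<rho>)"
      \<comment> \<open>Along the subsequence lower semicontinuity keeps \<open>F\<close> eventually
        above \<open>s\<close>, while the violated bound gives \<open>F < ?J\<close> and
        \<open>?J\<close> is eventually below \<open>s\<close>.\<close>
      then obtain s where s: "ereal (?J \<rho>) < ereal s" "ereal s < F \<rho>"
        using ereal_dense2 by (metis not_le)
      have "openin (weak_star (K \<times> K)) {\<mu>. signed_measure_on (K \<times> K) \<mu> \<and> ereal s < F \<mu>}"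
        using lsc unfolding weak_star_lsc_def by blast
      then have "eventually (\<lambda>n. \<pi> (r n) \<in> {\<mu>. signed_measure_on (K \<times> K) \<mu> \<and> ereal s < F \<mu>}) sequentially"
        using s(2) signed rho pi1 lim by (intro openin_weak_star_seq[where \<mu> = \<rho>]) auto
      moreover have "(\<lambda>n. ?J (\<pi> (r n))) \<longlonglongrightarrow> ?J \<rho>"
        by (intro tendsto_intros lim cont_snd W_cont)
      then have "eventually (\<lambda>n. ?J (\<pi> (r n)) < s) sequentially"
        using s(1) by (intro order_tendstoD) auto
      moreover have "eventually (\<lambda>n. p \<in> I (r n)) sequentially"
        using eventually_ge_at_top[of "max (fst p) (nat \<bar>snd p\<bar>)"]
      proof eventually_elim
        case (elim n)
        then have "max (fst p) (nat \<bar>snd p\<bar>) \<le> r n" using seq_suble[OF r, of n] by linarith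
        then show ?case unfolding I_def by (cases p) auto
      qed
      ultimately have "eventually (\<lambda>n. False) sequentially"
      proof eventually_elim
        case (elim n)
        then have "ereal s < ereal (real_of_ereal (F (\<pi> (r n))))" using F_real[OF piA] by auto
        then show False using elim pi_lt[of p "r n"] unfolding f_def by simp
      qed
      then show False by simp
    qed
    \<comment> \<open>The index \<open>(0, 0)\<close> gives the zero potential, so
      \<open>F_le\<close> is a finite bound on \<open>F \<rho>\<close> itself.\<close>
    have rhoA: "\<rho> \<in> A" using F_le[of "(0, 0)"] rho unfolding A_def by auto
    have prho: "prob_measure_on (K \<times> K) \<rho>" by (rule prob[OF rho])
    have int_W: "sm_integral (K \<times> K) \<rho> (\<lambda>z. W (i, j) (snd z)) = of_int j * sm_integral (K \<times> K) \<rho> (\<lambda>z. v i (snd z))"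
      "sm_integral K Q (W (i, j)) = of_int j * sm_integral K Q (v i)" for i j
      unfolding W_def using sm_integral_cmult[OF prho] sm_integral_cmult[OF Q] by auto
    have Q_eq: "sm_integral (K \<times> K) \<rho> (\<lambda>z. v i (snd z)) = sm_integral K Q (v i)" for i
    proof (rule ccontr)
      define d where "d = sm_integral (K \<times> K) \<rho> (\<lambda>z. v i (snd z)) - sm_integral K Q (v i)"
      assume "\<not> ?thesis"
      then have "d \<noteq> 0" unfolding d_def by simp
      \<comment> \<open>A nonzero \<open>d\<close> would make the multiples \<open>j * d\<close>
        unbounded below over the integers; one of \<open>j = m\<close> and \<open>j = - m\<close>
        violates the bound.\<close>
      have bound: "real_of_ereal (F \<rho>) - t \<le> of_int j * d" for j
      proof -
        have "ereal (real_of_ereal (F \<rho>)) \<le> ereal (t + of_int j * d)"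
          using F_le[of "(i, j)"] F_real[OF rhoA] unfolding int_W d_def
          by (simp add: algebra_simps)
        then show ?thesis by simp
      qed
      obtain m :: nat where m: "t - real_of_ereal (F \<rho>) < real m * \<bar>d\<bar>"
        using reals_Archimedean3[of "\<bar>d\<bar>"] \<open>d \<noteq> 0\<close> by auto
      show False
        using bound[of "int m"] bound[of "- int m"] m by (cases "d \<ge> 0") auto
    qed
    have "sm_pos K (snd_marg K \<rho>) = sm_pos K Q"
    proof (rule v_det[OF K])
      fix i
      show "integral\<^sup>L (sm_pos K (snd_marg K \<rho>)) (v i) = integral\<^sup>L (sm_pos K Q) (v i)"
        using Q_eq[of i] sm_integral_snd_marg[OF prho continuous_on_subset[OF v_cont subset_UNIV]]
        by (simp add: sm_integral_prob[OF Q] sm_integral_prob[OF prob_measure_on_snd_marg[OF prho]])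
    qed (use prob_space_sm_pos Q prob_measure_on_snd_marg[OF prho] in \<open>auto simp: sets_sm_pos\<close>)
    then have "snd_marg K \<rho> = Q"
      using measure_sm_pos[OF Q] measure_sm_pos[OF prob_measure_on_snd_marg[OF prho]] by simp
    then have "\<rho> \<in> Pi2 K P Q" using rho unfolding Pi1_def Pi2_def by simp
    then have "ereal t < F \<rho>" by (rule lb)
    moreover have "F \<rho> \<le> ereal t" using F_le[of "(0, 0)"] int_W[of 0 0] by simp
    ultimately show False by simp
  qed
  then obtain n where n: "\<And>\<pi>. \<pi> \<in> A \<Longrightarrow> \<exists>p\<in>I n. t \<le> f (W p) \<pi>" by blast
  obtain w where w: "sum w (I n) = 1" "\<forall>\<pi>\<in>A. t \<le> (\<Sum>p\<in>I n. w p * f (W p) \<pi>)"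
    using convexlike_finite[OF fin convexlike n] by blast
  show thesis
  proof (rule that)
    show c: "continuous_on K (\<lambda>y. \<Sum>p\<in>I n. w p * W p y)"
      by (intro continuous_intros W_cont)
    show "ereal t \<le> Lag K F Q (\<lambda>y. \<Sum>p\<in>I n. w p * W p y) \<pi>" if "\<pi> \<in> Pi1 K P" for \<pi>
      using w f_sum that by (intro Lag_lb c) auto
  qed
qed

section \<open>Optimality of transport plans for the Lagrangian at an optimal potential\<close>

theorem theorem2:
  fixes K :: "'a::euclidean_space set"
    and P Q :: "'a set \<Rightarrow> real"
    and F :: "(('a \<times> 'a) set \<Rightarrow> real) \<Rightarrow> ereal"
    and vstar :: "'a \<Rightarrow> real"
    and pistar :: "('a \<times> 'a) set \<Rightarrow> real"
  assumes K: "compact K"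
    and P: "prob_measure_on K P" and Q: "prob_measure_on K Q"
    and F_proper: "\<And>\<mu>. signed_measure_on (K \<times> K) \<mu> \<Longrightarrow> F \<mu> \<noteq> -\<infinity>"
    and F_convex: "sm_convex (K \<times> K) F"
    and F_lsc: "weak_star_lsc (K \<times> K) F"
    and F_sep: "sep_star_increasing K F"
    and finite_plan: "\<exists>\<pi>\<in>Pi2 K P Q. F \<pi> < \<infinity>"
    and vstar_cont: "continuous_on K vstar"
    and vstar_opt: "(INF \<pi>\<in>Pi1 K P. Lag K F Q vstar \<pi>) =
                    (SUP v\<in>{v. continuous_on K v}. INF \<pi>\<in>Pi1 K P. Lag K F Q v \<pi>)"
    and pistar_plan: "pistar \<in> Pi2 K P Q"
    and pistar_opt: "F pistar = (INF \<pi>\<in>Pi2 K P Q. F \<pi>)"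
  shows "pistar \<in> Pi1 K P \<and> Lag K F Q vstar pistar = (INF \<pi>\<in>Pi1 K P. Lag K F Q vstar \<pi>)"
proof
  show pi1: "pistar \<in> Pi1 K P" using pistar_plan by (simp add: Pi1_def Pi2_def)
  have "snd_marg K pistar = Q" "signed_measure_on (K \<times> K) pistar"
    using pistar_plan by (auto simp: Pi2_def prob_measure_on_def)
  then have Lag_pistar: "Lag K F Q vstar pistar = F pistar"
    using F_proper[of pistar] unfolding Lag_def by (cases "F pistar") auto
  have "F pistar \<le> (SUP v\<in>{v. continuous_on K v}. INF \<pi>\<in>Pi1 K P. Lag K F Q v \<pi>)"
  \<comment> \<open>It suffices to reach every value strictly below the cost, so no dual maximiser
    has to be produced; only real values are nontrivial.\<close>
  proof (rule dense_le)
    fix x assume x: "x < F pistar"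
    show "x \<le> (SUP v\<in>{v. continuous_on K v}. INF \<pi>\<in>Pi1 K P. Lag K F Q v \<pi>)"
    proof (cases x)
      case (real t)
      have "ereal t < F \<pi>" if "\<pi> \<in> Pi2 K P Q" for \<pi>
        using x that unfolding real pistar_opt by (metis INF_lower order_less_le_trans)
      then obtain v where "continuous_on K v" "\<And>\<pi>. \<pi> \<in> Pi1 K P \<Longrightarrow> ereal t \<le> Lag K F Q v \<pi>"
        using potential_of_lower_bound[OF K Q F_proper F_convex F_lsc] by metis
      then show ?thesis unfolding real by (intro SUP_upper2[of v] INF_greatest) auto
    qed (use x in auto)
  qed
  \<comment> \<open>Optimality of \<open>vstar\<close> turns the dual supremum into the infimum at
    \<open>vstar\<close>; the reverse inequality holds because \<open>pistar\<close> is itself a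
    competitor.\<close>
  then show "Lag K F Q vstar pistar = (INF \<pi>\<in>Pi1 K P. Lag K F Q vstar \<pi>)"
    using pi1 by (intro antisym INF_lower) (simp_all add: Lag_pistar vstar_opt)
qed

end
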